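(* Let $F$ be a self-similar set in $\mathbb{R}^d$ with Minkowski dimension $D\in(d-1,d)$ satisfying OSC. Assume there exists a strong feasible open set $O$ for $F$ such that $\partial O\subset F$, i.e. such that the generated tiling $\mathcal{T}=\mathcal{T}(O)$ is compatible. Let $K:=\overline O$, let $G$ be the generator of $\mathcal{T}$, $g$ the inradius of $G$, $T$ the union set of the tiles, and $\eta=-\sum_{i=1}^N r_i^D\ln r_i$. Then the $D$-dimensional outer Minkowski content of $K$ is zero, i.e. $\mathcal{M}^D(K,K^c)=0$. Moreover, the average Minkowski contents of $F$ and $\mathcal{T}$ coincide, i.e. $\widetilde{\mathcal{M}}^D(F)=\widetilde{\mathcal{M}}^D(\mathcal{T})$, and both are given by the finite and positive expression $$\frac1\eta\int_0^\infty\varepsilon^{D-d-1}V(G,\varepsilon)\,d\varepsilon ,$$ as well as by $$\frac1\eta\int_0^g\varepsilon^{D-d-1}h(\varepsilon)\,d\varepsilon,\qquad h(\varepsilon)=V(T,\varepsilon)-\sum_{i=1}^N\mathbf{1}_{(0,r_ig]}(\varepsilon)V(S_iT,\varepsilon).$$ Furthermore, $F$ is Minkowski measurable if and only if $\mathcal{T}$ is Minkowski measurable. In this case, the Minkowski content $\mathcal{M}^D(F)$ of $F$ (as well as $\mathcal{M}^D(\mathcal{T})$) is again given by $\frac1\eta\int_0^\infty\varepsilon^{D-d-1}V(G,\varepsilon)\,d\varepsilon$.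
   Context: Setting. $N\ge2$, $S_1,\dots,S_N:\mathbb{R}^d\to\mathbb{R}^d$ are contracting similarities with ratios $r_i\in(0,1)$ (an IFS), $\mathbf{S}(A):=\bigcup_{i=1}^N S_i(A)$, and the self-similar set $F$ is the unique nonempty compact set with $\mathbf{S}F=F$. The similarity dimension $D$ is the unique real solution of $\sum_{i=1}^N r_i^D=1$; under OSC it equals the Minkowski dimension of $F$. A feasible open set is a nonempty bounded open set $O$ with $S_iO\subset O$ for all $i$ and $S_iO\cap S_jO=\emptyset$ for $i\ne j$; OSC means that one exists; $O$ is strong if $O\cap F\ne\emptyset$. Tilings. Let $\Sigma_N^*=\bigcup_{n\ge0}\{1,\dots,N\}^n$, and for $\sigma=\sigma_1\cdots\sigma_n$ put $S_\sigma:=S_{\sigma_1}\circ\dots\circ S_{\sigma_n}$ (identity for the empty word). The generator is the open set $G:=O\setminus\mathbf{S}\overline O$; the self-similar tiling generated on $O$ is $\mathcal{T}(O):=\{S_\sigma G:\sigma\in\Sigma_N^*\}$ with union set $T:=\bigcup_{\sigma}S_\sigma G$. The tiling is called compatible if $\partial G\subset F$ (equivalently $\partial K\subset F$, $K=\overline O$). The inradius of $G$ is $g:=\sup\{d(x,\partial G):x\in G\}$. Minkowski contents. $\lambda_d$ is Lebesgue measure and $A_\varepsilon:=\{z:\inf_{a\in A}|a-z|\le\varepsilon\}$. For a bounded open set $U$, $V(U,\varepsilon):=\lambda_d(\{x\in U: d(x,\partial U)\le\varepsilon\})$. For bounded $A$ and $\Omega\subset\mathbb{R}^d$, $\mathcal{M}^s(A,\Omega):=\lim_{\varepsilon\searrow0}\varepsilon^{s-d}\lambda_d(A_\varepsilon\cap\Omega)$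 and $\widetilde{\mathcal{M}}^s(A,\Omega):=\lim_{\delta\searrow0}\frac1{|\ln\delta|}\int_\delta^1\varepsilon^{s-d}\lambda_d(A_\varepsilon\cap\Omega)\frac{d\varepsilon}{\varepsilon}$, whenever the limits exist; $\mathcal{M}^s(A):=\mathcal{M}^s(A,\mathbb{R}^d)$, $\widetilde{\mathcal{M}}^s(A):=\widetilde{\mathcal{M}}^s(A,\mathbb{R}^d)$. For the tiling, $\mathcal{M}^D(\mathcal{T}):=\mathcal{M}^D(\partial T,T)=\lim_{\varepsilon\searrow0}\varepsilon^{D-d}V(T,\varepsilon)$ and $\widetilde{\mathcal{M}}^D(\mathcal{T}):=\widetilde{\mathcal{M}}^D(\partial T,T)$. A bounded set $A$ is Minkowski measurable if $\mathcal{M}^s(A)$ exists and is positive and finite for some $s\ge0$; $\mathcal{T}$ is Minkowski measurable if $\mathcal{M}^D(\mathcal{T})$ exists and is positive and finite. *)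

theory Defs
  imports "HOL-Analysis.Analysis"
begin

section \<open>Iterated function systems of similarities\<close>

definition similarity_ifs :: "nat \<Rightarrow> (nat \<Rightarrow> 'a::euclidean_space \<Rightarrow> 'a) \<Rightarrow> (nat \<Rightarrow> real) \<Rightarrow> bool"
  where "similarity_ifs N S r \<longleftrightarrow>
    2 \<le> N \<and>
    (\<forall>i\<in>{1..N}. 0 < r i \<and> r i < 1 \<and> (\<forall>x y. dist (S i x) (S i y) = r i * dist x y))"

definition ifs_op :: "nat \<Rightarrow> (nat \<Rightarrow> 'a \<Rightarrow> 'a) \<Rightarrow> 'a set \<Rightarrow> 'a set"
  where "ifs_op N S A = (\<Union>i\<in>{1..N}. S i ` A)"

(* For contractions there is exactly one such F. *)
definition self_similar_set :: "nat \<Rightarrow> (nat \<Rightarrow> 'a::euclidean_space \<Rightarrow> 'a) \<Rightarrow> 'a set \<Rightarrow> bool"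
  where "self_similar_set N S F \<longleftrightarrow> F \<noteq> {} \<and> compact F \<and> ifs_op N S F = F"

definition feasible_open_set :: "nat \<Rightarrow> (nat \<Rightarrow> 'a::euclidean_space \<Rightarrow> 'a) \<Rightarrow> 'a set \<Rightarrow> bool"
  where "feasible_open_set N S U \<longleftrightarrow>
    U \<noteq> {} \<and> bounded U \<and> open U \<and>
    (\<forall>i\<in>{1..N}. S i ` U \<subseteq> U) \<and>
    (\<forall>i\<in>{1..N}. \<forall>j\<in>{1..N}. i \<noteq> j \<longrightarrow> S i ` U \<inter> S j ` U = {})"

definition open_set_condition :: "nat \<Rightarrow> (nat \<Rightarrow> 'a::euclidean_space \<Rightarrow> 'a) \<Rightarrow> bool"
  where "open_set_condition N S \<longleftrightarrow> (\<exists>U. feasible_open_set N S U)"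

definition strong_feasible_open_set ::
    "nat \<Rightarrow> (nat \<Rightarrow> 'a::euclidean_space \<Rightarrow> 'a) \<Rightarrow> 'a set \<Rightarrow> 'a set \<Rightarrow> bool"
  where "strong_feasible_open_set N S F U \<longleftrightarrow> feasible_open_set N S U \<and> U \<inter> F \<noteq> {}"

section \<open>Self-similar tilings\<close>

fun word_map :: "(nat \<Rightarrow> 'a \<Rightarrow> 'a) \<Rightarrow> nat list \<Rightarrow> 'a \<Rightarrow> 'a"
  where
    "word_map S [] = id"
  | "word_map S (i # w) = S i \<circ> word_map S w"

definition generator :: "nat \<Rightarrow> (nat \<Rightarrow> 'a::euclidean_space \<Rightarrow> 'a) \<Rightarrow> 'a set \<Rightarrow> 'a set"
  where "generator N S U = U - ifs_op N S (closure U)"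

definition tiling :: "nat \<Rightarrow> (nat \<Rightarrow> 'a::euclidean_space \<Rightarrow> 'a) \<Rightarrow> 'a set \<Rightarrow> 'a set set"
  where "tiling N S U = {word_map S w ` generator N S U | w. w \<in> lists {1..N}}"

definition tiling_union :: "nat \<Rightarrow> (nat \<Rightarrow> 'a::euclidean_space \<Rightarrow> 'a) \<Rightarrow> 'a set \<Rightarrow> 'a set"
  where "tiling_union N S U = \<Union> (tiling N S U)"

definition inradius :: "'a::euclidean_space set \<Rightarrow> real"
  where "inradius A = (SUP x\<in>A. infdist x (frontier A))"

section \<open>Parallel volumes and Minkowski contents\<close>

(* The guard makes the parallel set of the empty set empty; infdist to the empty set is 0. *)
definition parallel_set :: "'a::euclidean_space set \<Rightarrow> real \<Rightarrow> 'a set"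
  where "parallel_set A e = {z. A \<noteq> {} \<and> infdist z A \<le> e}"

(* Applied to bounded open U: a nonempty one has a nonempty frontier. *)
definition inner_volume :: "'a::euclidean_space set \<Rightarrow> real \<Rightarrow> real"
  where "inner_volume U e = measure lebesgue {x\<in>U. infdist x (frontier U) \<le> e}"

definition has_minkowski_dimension :: "'a::euclidean_space set \<Rightarrow> real \<Rightarrow> bool"
  where "has_minkowski_dimension A s \<longleftrightarrow>
    A \<noteq> {} \<and> bounded A \<and>
    ((\<lambda>e. real DIM('a) - ln (measure lebesgue (parallel_set A e)) / ln e) \<longlongrightarrow> s) (at_right 0)"

(* "has_" rather than a real-valued function: the limit is asserted to exist and to be finite. *)
definition has_minkowski_content ::
    "real \<Rightarrow> 'a::euclidean_space set \<Rightarrow> 'a set \<Rightarrow> real \<Rightarrow> bool"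
  where "has_minkowski_content s A \<Omega> m \<longleftrightarrow>
    ((\<lambda>e. e powr (s - real DIM('a)) * measure lebesgue (parallel_set A e \<inter> \<Omega>)) \<longlongrightarrow> m)
      (at_right 0)"

definition has_average_minkowski_content ::
    "real \<Rightarrow> 'a::euclidean_space set \<Rightarrow> 'a set \<Rightarrow> real \<Rightarrow> bool"
  where "has_average_minkowski_content s A \<Omega> m \<longleftrightarrow>
    ((\<lambda>\<delta>. 1 / \<bar>ln \<delta>\<bar> *
        (LBINT e:{\<delta>..1}.
           e powr (s - real DIM('a)) * measure lebesgue (parallel_set A e \<inter> \<Omega>) / e)) \<longlongrightarrow> m)
      (at_right 0)"

definition minkowski_measurable :: "'a::euclidean_space set \<Rightarrow> bool"
  where "minkowski_measurable A \<longleftrightarrow>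
    bounded A \<and> (\<exists>s\<ge>0. \<exists>m>0. has_minkowski_content s A UNIV m)"

(* The contents of a tiling are the relative contents of (frontier T, T), T the union of its
   tiles; the exponent D is fixed, in contrast to minkowski_measurable. *)
definition tiling_has_minkowski_content :: "real \<Rightarrow> 'a::euclidean_space set set \<Rightarrow> real \<Rightarrow> bool"
  where "tiling_has_minkowski_content D \<T> m \<longleftrightarrow>
    has_minkowski_content D (frontier (\<Union>\<T>)) (\<Union>\<T>) m"

definition tiling_has_average_minkowski_content ::
    "real \<Rightarrow> 'a::euclidean_space set set \<Rightarrow> real \<Rightarrow> bool"
  where "tiling_has_average_minkowski_content D \<T> m \<longleftrightarrow>
    has_average_minkowski_content D (frontier (\<Union>\<T>)) (\<Union>\<T>) m"

definition tiling_minkowski_measurable :: "real \<Rightarrow> 'a::euclidean_space set set \<Rightarrow> bool"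
  where "tiling_minkowski_measurable D \<T> \<longleftrightarrow>
    (\<exists>m>0. tiling_has_minkowski_content D \<T> m)"

end

theory Submission
  imports Defs
begin

text \<open>
  The proof rests on an exact renewal equation.  Write \<open>F\<^sub>e\<close> for the closed parallel set
  of \<open>F\<close>, split \<open>|F\<^sub>e|\<close> into the inner part \<open>w e = |F\<^sub>e \<inter> U|\<close>
  (\<open>collar\<close>) and the outer part \<open>|F\<^sub>e - U|\<close> (\<open>outer_collar\<close>).

  Because the frontier of \<open>U\<close> lies in \<open>F\<close>, a segment leaving \<open>S i ` U\<close> or the generator
  \<open>G\<close> meets \<open>F\<close> when it crosses the frontier.  Hence distances to \<open>F\<close> inside
  \<open>S i ` U\<close> are scaled distances inside \<open>U\<close>, and distances to \<open>F\<close> inside \<open>G\<close> are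
  distances to the frontier of \<open>G\<close>.  As \<open>U\<close> is the union of \<open>G\<close> and the copies
  \<open>S i ` U\<close> up to a null set, \<open>w e = (\<Sum>i. r i ^ d * w (e / r i)) + V(G, e)\<close> for every
  \<open>e\<close> (\<open>collar_renewal\<close>).  The tiles fill \<open>U - F\<close> (\<open>T_eq\<close>) and \<open>F\<close> is a null
  set, so \<open>w\<close> is also the inner parallel volume of the tiling.

  Integrating the equation against \<open>e powr (D - d - 1)\<close> over \<open>e > \<delta>\<close> gives
  \<open>source_tail_eq_window\<close>: the integral of \<open>V(G, e)\<close> over the tail equals a weighted sum of
  integrals of \<open>w\<close> over the windows from \<open>\<delta>\<close> to \<open>\<delta> / r i\<close>, whose total logarithmic length
  is \<open>\<eta>\<close>.  As \<open>\<delta>\<close> tends to zero the windows converge to the integral over all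
  \<open>e > 0\<close>.  This determines the average content (\<open>tail_over_log_tendsto\<close>) and the only possible
  value of the content (\<open>limit_eq_average\<close>), bounds \<open>w\<close> from below (\<open>w_growth_lower\<close>), and
  with \<open>\<delta> = g\<close> gives the formula in terms of \<open>h\<close> (\<open>truncated_difference\<close>).  The averages
  converge by a maximum principle for functions dominated by weighted means of their rescalings
  (\<open>scaling_maximum_principle\<close>).

  The outer part is of lower order: as \<open>U\<close> meets \<open>F\<close>, some copy of \<open>F\<close> is well inside
  \<open>U\<close> and, for small \<open>e\<close>, may be omitted from the covering of \<open>F\<^sub>e - U\<close> by copies;
  this lowers the growth exponent (\<open>outer_collar_growth\<close>).  So the outer content of \<open>closure U\<close> vanishes and \<open>F\<close>
  and the tiling have the same contents.  Finally, the two-sided bounds on \<open>|F\<^sub>e|\<close> identify the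
  Minkowski dimension with the solution of the Moran equation
  (\<open>minkowski_dimension_eq_moran_exponent\<close>), and likewise any exponent for which \<open>F\<close> has a
  positive finite content.
\<close>

section \<open>Similarities of Euclidean space\<close>

locale similarity =
  fixes f :: "'a::euclidean_space \<Rightarrow> 'a" and r :: real
  assumes ratio_pos: "0 < r" and dist_map: "dist (f x) (f y) = r * dist x y"
begin

lemma inj_map: "inj f"
  using dist_map ratio_pos by (metis dist_eq_0_iff injI mult_eq_0_iff order_less_irrefl)

lemma surj_map: "surj f"
proof -
  \<comment> \<open>Up to the factor \<open>r\<close> and a translation, \<open>f\<close> is an isometry fixing the origin, hence linear.\<close>
  define h where "h x = (f x - f 0) /\<^sub>R r" for x
  have h: "dist (h x) (h y) = dist x y" for x y
  proof -
    have "dist (h x) (h y) = norm ((f x - f y) /\<^sub>R r)"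
      by (simp add: h_def dist_norm flip: scaleR_right_diff_distrib)
    also have "\<dots> = dist x y"
      using ratio_pos dist_map[of x y] by (simp add: dist_norm)
    finally show ?thesis .
  qed
  then have "linear h"
    by (intro isometry_linear) (auto simp: h_def)
  moreover have "inj h"
    using h by (metis dist_eq_0_iff injI)
  ultimately have "surj h"
    by (rule linear_inj_imp_surj)
  show ?thesis
  proof (rule surjI)
    fix y
    have "h (inv h ((y - f 0) /\<^sub>R r)) = (y - f 0) /\<^sub>R r"
      using \<open>surj h\<close> by (rule surj_f_inv_f)
    then show "f (inv h ((y - f 0) /\<^sub>R r)) = y"
      using ratio_pos unfolding h_def by simp
  qed
qed

lemma inv_map_similarity: "similarity (inv f) (1 / r)"
proof
  show "0 < 1 / r"
    using ratio_pos by simp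
  show "dist (inv f x) (inv f y) = 1 / r * dist x y" for x y
    using dist_map[of "inv f x" "inv f y"] ratio_pos surj_map by (simp add: surj_f_inv_f)
qed

lemma continuous_on_map: "continuous_on A f"
proof (rule continuous_on_iff[THEN iffD2], intro ballI allI impI)
  fix x e :: _ and e' :: real
  assume "x \<in> A" "0 < e'"
  then show "\<exists>d>0. \<forall>x'\<in>A. dist x' x < d \<longrightarrow> dist (f x') (f x) < e'"
    using ratio_pos by (intro exI[of _ "e' / r"]) (auto simp: dist_map field_simps)
qed

lemma image_eq_vimage_inv: "f ` A = inv f -` A"
  using inj_map surj_map by (auto simp: surj_f_inv_f image_iff) (metis surj_f_inv_f)

lemma open_image: "open A \<Longrightarrow> open (f ` A)"
  unfolding image_eq_vimage_inv
  by (rule open_vimage[OF _ similarity.continuous_on_map[OF inv_map_similarity]])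

lemma borel_image: "A \<in> sets borel \<Longrightarrow> f ` A \<in> sets borel"
  unfolding image_eq_vimage_inv
  using measurable_sets[OF borel_measurable_continuous_onI[OF similarity.continuous_on_map[OF inv_map_similarity]]]
  by (simp add: space_borel)

lemma closure_image: "closure (f ` A) = f ` closure A"
proof
  have "closed (f ` closure A)"
    unfolding image_eq_vimage_inv
    by (rule closed_vimage[OF _ similarity.continuous_on_map[OF inv_map_similarity]]) simp
  then show "closure (f ` A) \<subseteq> f ` closure A"
    by (intro closure_minimal image_mono closure_subset)
  show "f ` closure A \<subseteq> closure (f ` A)"
    by (rule image_closure_subset[OF continuous_on_map]) (auto intro: closure_subset[THEN subsetD])
qed

lemma frontier_image: "frontier (f ` A) = f ` frontier A"
proof -
  have compl: "- f ` A = f ` (- A)" for A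
    using inj_map surj_map by (simp add: bij_image_Compl_eq bij_def)
  show ?thesis
    unfolding frontier_closures compl closure_image by (rule image_Int[OF inj_map, symmetric])
qed

lemma infdist_image: "A \<noteq> {} \<Longrightarrow> infdist (f x) (f ` A) = r * infdist x A"
proof -
  assume A: "A \<noteq> {}"
  have "bdd_below ((\<lambda>a. dist x a) ` A)"
    by (rule bdd_belowI[of _ 0]) auto
  then have "(INF a\<in>A. r * dist x a) = r * (INF a\<in>A. dist x a)"
    using continuous_at_Inf_mono[of "\<lambda>t. r * t" "dist x ` A"] A ratio_pos
    by (simp add: mono_def image_image continuous_intros)
  then show "infdist (f x) (f ` A) = r * infdist x A"
    using A by (simp add: infdist_def dist_map image_image)
qed

lemma image_cball: "f ` cball a t = cball (f a) (r * t)"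
proof -
  have "y \<in> f ` cball a t" if "y \<in> cball (f a) (r * t)" for y
  proof -
    obtain x where x: "y = f x"
      using surj_map by (metis surjD)
    with that ratio_pos show ?thesis
      by (auto simp: dist_map)
  qed
  then show ?thesis
    using ratio_pos by (auto simp: dist_map)
qed

lemma negligible_image:
  assumes "negligible A"
  shows "negligible (f ` A)"
proof (rule negligible_locally_Lipschitz_image[OF order_refl assms])
  show "\<exists>T B. open T \<and> x \<in> T \<and> (\<forall>y\<in>A \<inter> T. norm (f y - f x) \<le> B * norm (y - x))" for x
    by (intro exI[of _ UNIV] exI[of _ r]) (simp add: dist_map flip: dist_norm)
qed

lemma emeasure_cball_scaled:
  "emeasure lebesgue (cball (f a) (r * t)) = ennreal (r ^ DIM('a)) * emeasure lebesgue (cball a t)"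
proof (cases "t \<ge> 0")
  case True
  then show ?thesis
    using ratio_pos by (simp add: emeasure_cball power_mult_distrib ennreal_mult'' mult_ac)
next
  case False
  then have "r * t < 0"
    using ratio_pos by (simp add: mult_less_0_iff)
  then show ?thesis
    using False by simp
qed

text \<open>Balls scale correctly by their volume formula.  By Vitali's covering theorem an open set is a
disjoint union of closed balls up to a null set, and a Lipschitz map sends null sets to null sets.\<close>

lemma emeasure_image_open:
  assumes "open A"
  shows "emeasure lebesgue (f ` A) = ennreal (r ^ DIM('a)) * emeasure lebesgue A"
proof -
  define Q where "Q = {(x, t). 0 < t \<and> cball x t \<subseteq> A}"
  have Q: "\<exists>i. i \<in> Q \<and> x \<in> cball (fst i) (snd i) \<and> snd i < d" if "x \<in> A" "0 < d" for x d
  proof -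
    obtain e where "e > 0" "cball x e \<subseteq> A"
      using \<open>open A\<close> \<open>x \<in> A\<close> open_contains_cball by blast
    moreover have "cball x (min e (d / 2)) \<subseteq> cball x e"
      by (rule subset_cball) simp
    ultimately show ?thesis
      using \<open>0 < d\<close> by (intro exI[of _ "(x, min e (d / 2))"]) (auto simp: Q_def)
  qed
  obtain C where C: "countable C" "C \<subseteq> Q"
     "pairwise (\<lambda>i j. disjnt (cball (fst i) (snd i)) (cball (fst j) (snd j))) C"
     "negligible (A - (\<Union>i \<in> C. cball (fst i) (snd i)))"
    by (rule Vitali_covering_theorem_cballs[of Q snd A fst]) (use Q in \<open>auto simp: Q_def\<close>)
  define B where "B = (\<Union>i\<in>C. cball (fst i) (snd i))"
  have "B \<subseteq> A"
    using C(2) by (force simp: B_def Q_def)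
  have disj: "disjoint_family_on (\<lambda>i. cball (fst i) (snd i)) C"
    using C(3) by (auto simp: disjoint_family_on_def pairwise_def disjnt_def)
  have disj': "disjoint_family_on (\<lambda>i. cball (f (fst i)) (r * snd i)) C"
    using disj unfolding image_cball[symmetric] disjoint_family_on_def
    by (simp add: image_Int[OF inj_map, symmetric])
  have fB: "f ` B = (\<Union>i\<in>C. cball (f (fst i)) (r * snd i))"
    by (simp add: B_def image_UN image_cball)
  have B: "B \<in> sets lebesgue" "f ` B \<in> sets lebesgue"
    unfolding fB using C(1) by (auto simp: B_def intro!: sets.countable_UN')
  have N: "A - B \<in> null_sets lebesgue" "f ` (A - B) \<in> null_sets lebesgue"
    using C(4) negligible_image[of "A - B"] by (simp_all add: B_def negligible_iff_null_sets)
  have "emeasure lebesgue (f ` A) = emeasure lebesgue (f ` B \<union> f ` (A - B))"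
    using \<open>B \<subseteq> A\<close> by (metis Diff_partition image_Un)
  also have "\<dots> = emeasure lebesgue (f ` B)"
    by (rule emeasure_Un_null_set) (use B N in auto)
  also have "\<dots> = (\<integral>\<^sup>+i. emeasure lebesgue (cball (f (fst i)) (r * snd i)) \<partial>count_space C)"
    unfolding fB using C(1) disj' by (intro emeasure_UN_countable) auto
  also have "\<dots> = ennreal (r ^ DIM('a)) * (\<integral>\<^sup>+i. emeasure lebesgue (cball (fst i) (snd i)) \<partial>count_space C)"
    unfolding emeasure_cball_scaled by (rule nn_integral_cmult) simp
  also have "(\<integral>\<^sup>+i. emeasure lebesgue (cball (fst i) (snd i)) \<partial>count_space C) = emeasure lebesgue B"
    unfolding B_def using C(1) disj by (intro emeasure_UN_countable[symmetric]) auto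
  also have "emeasure lebesgue B = emeasure lebesgue (B \<union> (A - B))"
    by (rule emeasure_Un_null_set[symmetric]) (use B N in auto)
  also have "B \<union> (A - B) = A"
    using \<open>B \<subseteq> A\<close> by blast
  finally show ?thesis .
qed

text \<open>Pulling Lebesgue measure back along \<open>f\<close> and normalising gives a measure that agrees with
Lebesgue measure on boxes, hence everywhere.\<close>

lemma emeasure_image_borel:
  assumes "A \<in> sets borel"
  shows "emeasure lborel (f ` A) = ennreal (r ^ DIM('a)) * emeasure lborel A"
proof -
  define M where "M = density (distr lborel borel (inv f)) (\<lambda>_. ennreal (1 / r ^ DIM('a)))"
  have inv_meas: "inv f \<in> borel_measurable borel"
    by (intro borel_measurable_continuous_onI similarity.continuous_on_map[OF inv_map_similarity])
  have M: "emeasure M X = ennreal (1 / r ^ DIM('a)) * emeasure lborel (f ` X)" if "X \<in> sets borel" for X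
    using that inv_meas
    by (simp add: M_def emeasure_density_const emeasure_distr image_eq_vimage_inv)
  have one: "ennreal (1 / r ^ DIM('a)) * ennreal (r ^ DIM('a)) = 1"
    using ratio_pos by (simp flip: ennreal_mult'')
  have "lborel = M"
  proof (rule lborel_eqI)
    fix l u :: 'a
    assume lu: "\<And>b. b \<in> Basis \<Longrightarrow> l \<bullet> b \<le> u \<bullet> b"
    have "emeasure lborel (f ` box l u) = emeasure lebesgue (f ` box l u)"
      by (simp add: borel_image)
    also have "\<dots> = ennreal (r ^ DIM('a)) * emeasure lborel (box l u)"
      using emeasure_image_open[OF open_box, of l u] by simp
    finally have "emeasure M (box l u) = emeasure lborel (box l u)"
      by (simp add: M one flip: mult.assoc)
    then show "emeasure M (box l u) = (\<Prod>b\<in>Basis. (u - l) \<bullet> b)"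
      using lu by (simp add: emeasure_lborel_box)
  qed (simp add: M_def)
  then have "ennreal (r ^ DIM('a)) * emeasure lborel A = ennreal (r ^ DIM('a)) * emeasure M A"
    by simp
  also have "\<dots> = emeasure lborel (f ` A)"
    using one by (simp add: M[OF assms] mult.commute flip: mult.assoc)
  finally show ?thesis ..
qed

lemma measure_image_borel:
  assumes "A \<in> sets borel"
  shows "measure lebesgue (f ` A) = r powr DIM('a) * measure lebesgue A"
  using ratio_pos assms
  by (simp add: measure_def emeasure_image_borel borel_image enn2real_mult powr_realpow)

end

section \<open>Functions controlled by their rescalings\<close>

text \<open>A bound on the window \<open>[\<alpha>, \<alpha> / b]\<close> is propagated towards the origin: every
\<open>\<epsilon> / \<rho> i\<close> is larger than \<open>\<epsilon>\<close> by at least a fixed factor, so the region where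
the bound is known grows geometrically, and a subconvex combination of values at most \<open>C\<close>
is at most \<open>C\<close>.\<close>

lemma scaling_maximum_principle:
  fixes u :: "real \<Rightarrow> real" and \<rho> p :: "'i \<Rightarrow> real"
  assumes I: "finite I" "\<And>i. i \<in> I \<Longrightarrow> b \<le> \<rho> i \<and> \<rho> i < 1" "0 < b"
    and p: "\<And>i. i \<in> I \<Longrightarrow> 0 \<le> p i" "(\<Sum>i\<in>I. p i) \<le> 1"
    and C: "0 \<le> C" "\<And>\<epsilon>. \<alpha> \<le> \<epsilon> \<Longrightarrow> \<epsilon> \<le> \<alpha> / b \<Longrightarrow> u \<epsilon> \<le> C"
    and step: "\<And>\<epsilon>. 0 < \<epsilon> \<Longrightarrow> \<epsilon> < \<alpha> \<Longrightarrow> u \<epsilon> \<le> (\<Sum>i\<in>I. p i * u (\<epsilon> / \<rho> i))"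
    and \<epsilon>: "0 < \<epsilon>" "\<epsilon> \<le> \<alpha> / b"
  shows "u \<epsilon> \<le> C"
proof -
  obtain \<mu> where \<mu>: "0 < \<mu>" "\<mu> < 1" "\<And>i. i \<in> I \<Longrightarrow> \<rho> i \<le> \<mu>"
  proof -
    have fin: "finite (insert (1/2) (\<rho> ` I))"
      using I(1) by simp
    show thesis
    proof
      show "\<rho> i \<le> Max (insert (1/2) (\<rho> ` I))" if "i \<in> I" for i
        using that fin by (intro Max_ge) auto
      show "0 < Max (insert (1/2) (\<rho> ` I))" "Max (insert (1/2) (\<rho> ` I)) < 1"
        using fin I(2) by (auto simp: Max_gr_iff)
    qed
  qed
  have claim: "u \<epsilon> \<le> C" if "0 < \<epsilon>" "\<alpha> * \<mu> ^ n \<le> \<epsilon>" "\<epsilon> \<le> \<alpha> / b" for n \<epsilon>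
    using that
  proof (induction n arbitrary: \<epsilon>)
    case 0
    then show ?case
      using C(2) by simp
  next
    case (Suc n)
    show ?case
    proof (cases "\<alpha> \<le> \<epsilon>")
      case True
      then show ?thesis
        using C(2) Suc.prems by simp
    next
      case False
      have "u (\<epsilon> / \<rho> i) \<le> C" if "i \<in> I" for i
      proof (rule Suc.IH)
        have \<rho>: "0 < \<rho> i" "\<rho> i \<le> \<mu>" "b \<le> \<rho> i"
          using I(2)[OF that] I(3) \<mu>(3)[OF that] by auto
        then show "0 < \<epsilon> / \<rho> i"
          using Suc.prems(1) by simp
        have "\<alpha> * \<mu> ^ n \<le> \<epsilon> / \<mu>"
          using Suc.prems(2) \<mu>(1) by (simp add: field_simps)
        also have "\<dots> \<le> \<epsilon> / \<rho> i"
          using \<rho> Suc.prems(1) by (simp add: frac_le)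
        finally show "\<alpha> * \<mu> ^ n \<le> \<epsilon> / \<rho> i" .
        show "\<epsilon> / \<rho> i \<le> \<alpha> / b"
          using \<rho> False Suc.prems(1) I(3) by (intro frac_le) auto
      qed
      then have "(\<Sum>i\<in>I. p i * u (\<epsilon> / \<rho> i)) \<le> (\<Sum>i\<in>I. p i * C)"
        using p(1) by (intro sum_mono mult_left_mono) auto
      also have "\<dots> = (\<Sum>i\<in>I. p i) * C"
        by (simp add: sum_distrib_right)
      also have "\<dots> \<le> C"
        using p(2) C(1) mult_right_mono[of "\<Sum>i\<in>I. p i" 1 C] by simp
      finally show ?thesis
        using step[of \<epsilon>] False Suc.prems(1) by linarith
    qed
  qed
  have "(\<lambda>n. \<alpha> * \<mu> ^ n) \<longlonglongrightarrow> \<alpha> * 0"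
    using \<mu> by (intro tendsto_mult tendsto_const LIMSEQ_power_zero) auto
  then have "\<forall>\<^sub>F n in sequentially. \<alpha> * \<mu> ^ n < \<epsilon>"
    using \<epsilon>(1) by (intro order_tendstoD) simp_all
  then obtain n where "\<alpha> * \<mu> ^ n < \<epsilon>"
    by (auto simp: eventually_sequentially)
  then show ?thesis
    using claim[of \<epsilon> n] \<epsilon> by simp
qed

text \<open>The maximum principle for \<open>f \<epsilon> * \<epsilon> powr - t\<close>: a scaling inequality forces power decay,
with an exponent read off from the Moran-type sum of the weights.\<close>

lemma scaling_growth_bound:
  fixes f :: "real \<Rightarrow> real" and \<rho> q :: "'i \<Rightarrow> real"
  assumes I: "finite I" "\<And>i. i \<in> I \<Longrightarrow> 0 < \<rho> i \<and> \<rho> i < 1"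
    and q: "\<And>i. i \<in> I \<Longrightarrow> 0 \<le> q i" "(\<Sum>i\<in>I. q i * \<rho> i powr - t) \<le> 1"
    and f: "mono f" "\<And>\<epsilon>. 0 \<le> f \<epsilon>" and t: "0 \<le> t" and \<alpha>: "0 < \<alpha>"
    and step: "\<And>\<epsilon>. 0 < \<epsilon> \<Longrightarrow> \<epsilon> < \<alpha> \<Longrightarrow> f \<epsilon> \<le> (\<Sum>i\<in>I. q i * f (\<epsilon> / \<rho> i))"
  shows "\<exists>M\<ge>0. \<forall>\<epsilon>. 0 < \<epsilon> \<and> \<epsilon> \<le> \<alpha> \<longrightarrow> f \<epsilon> \<le> M * \<epsilon> powr t"
proof -
  define b where "b = Min (insert 1 (\<rho> ` I))"
  have fin: "finite (insert 1 (\<rho> ` I))"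
    using I(1) by simp
  have b: "0 < b" "b \<le> 1" "\<And>i. i \<in> I \<Longrightarrow> b \<le> \<rho> i"
    using fin I(2) by (auto simp: b_def)
  define u where "u \<epsilon> = f \<epsilon> * \<epsilon> powr - t" for \<epsilon>
  define C where "C = f (\<alpha> / b) * \<alpha> powr - t"
  have C: "0 \<le> C"
    using f(2) by (simp add: C_def)
  have "u \<epsilon> \<le> C" if \<epsilon>: "0 < \<epsilon>" "\<epsilon> \<le> \<alpha> / b" for \<epsilon>
  proof (rule scaling_maximum_principle[where I = I and \<rho> = \<rho> and b = b and \<alpha> = \<alpha>
        and p = "\<lambda>i. q i * \<rho> i powr - t" and u = u, OF I(1) _ b(1) _ q(2) C _ _ \<epsilon>])
    show "b \<le> \<rho> i \<and> \<rho> i < 1" if "i \<in> I" for i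
      using b(3) I(2) that by auto
    show "0 \<le> q i * \<rho> i powr - t" if "i \<in> I" for i
      using q(1) that by simp
    show "u \<epsilon> \<le> C" if "\<alpha> \<le> \<epsilon>" "\<epsilon> \<le> \<alpha> / b" for \<epsilon>
      unfolding u_def C_def using that f \<alpha> t
      by (intro mult_mono monoD[OF f(1)] powr_mono2') auto
    show "u \<epsilon> \<le> (\<Sum>i\<in>I. q i * \<rho> i powr - t * u (\<epsilon> / \<rho> i))" if "0 < \<epsilon>" "\<epsilon> < \<alpha>" for \<epsilon>
    proof -
      have "u \<epsilon> \<le> (\<Sum>i\<in>I. q i * f (\<epsilon> / \<rho> i)) * \<epsilon> powr - t"
        unfolding u_def using step[OF that] by (intro mult_right_mono) auto
      also have "\<dots> = (\<Sum>i\<in>I. q i * \<rho> i powr - t * u (\<epsilon> / \<rho> i))"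
        unfolding sum_distrib_right
      proof (rule sum.cong[OF refl])
        fix i assume "i \<in> I"
        then have "0 < \<rho> i"
          using I(2) by auto
        then show "q i * f (\<epsilon> / \<rho> i) * \<epsilon> powr - t = q i * \<rho> i powr - t * u (\<epsilon> / \<rho> i)"
          using that(1) by (simp add: u_def powr_divide powr_minus field_simps)
      qed
      finally show ?thesis .
    qed
  qed
  then have "f \<epsilon> \<le> C * \<epsilon> powr t" if "0 < \<epsilon>" "\<epsilon> \<le> \<alpha>" for \<epsilon>
  proof -
    have "\<epsilon> \<le> \<alpha> / b"
      using that b \<alpha> by (smt (verit) le_divide_eq_1_pos mult_imp_le_div_pos mult_left_le)
    then have "f \<epsilon> * \<epsilon> powr - t \<le> C"
      using \<open>\<And>\<epsilon>. 0 < \<epsilon> \<Longrightarrow> \<epsilon> \<le> \<alpha> / b \<Longrightarrow> u \<epsilon> \<le> C\<close> that(1) by (simp add: u_def)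
    then show ?thesis
      using that(1) by (simp add: powr_minus field_simps)
  qed
  then show ?thesis
    using C by blast
qed

section \<open>The renewal equation\<close>

lemma set_integrable_powr_Ioi:
  fixes a \<delta> :: real
  assumes "a < -1" "0 < \<delta>"
  shows "set_integrable lborel {\<delta><..} (\<lambda>x. x powr a)"
proof -
  have "(\<lambda>x. x powr a) integrable_on {\<delta>..}"
    using has_integral_powr_to_inf[OF assms] by (rule has_integral_integrable)
  then have "set_integrable lebesgue {\<delta>..} (\<lambda>x. x powr a)"
    by (subst absolutely_integrable_on_iff_nonneg) auto
  then have "set_integrable lborel {\<delta>..} (\<lambda>x. x powr a)"
    unfolding set_integrable_def by (subst (asm) integrable_completion) auto
  then show ?thesis
    by (rule set_integrable_subset) auto
qed

lemma set_integral_Icc_eq_Ioc: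
  fixes f :: "real \<Rightarrow> real"
  shows "(LBINT x:{a..b}. f x) = (LBINT x:{a<..b}. f x)"
  unfolding set_lebesgue_integral_def
  by (rule integral_discrete_difference[of "{a}"]) (auto simp: indicator_def)

lemma set_integrable_inverse_Ioc:
  fixes a b :: real
  assumes "0 < a"
  shows "set_integrable lborel {a<..b} (\<lambda>x. 1 / x)"
proof -
  have "set_integrable lborel {a..b} (\<lambda>x. 1 / x)"
    using assms by (intro borel_integrable_atLeastAtMost' continuous_intros) auto
  then show ?thesis
    by (rule set_integrable_subset) auto
qed

lemma set_integral_inverse_Ioc:
  fixes a b :: real
  assumes "0 < a" "a \<le> b"
  shows "(LBINT x:{a<..b}. 1 / x) = ln b - ln a"
proof -
  have "(LBINT x:{a..b}. 1 / x) = ln b - ln a"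
    unfolding set_lebesgue_integral_def using assms
    by (intro integral_FTC_Icc)
       (auto intro!: continuous_intros derivative_eq_intros simp flip: has_real_derivative_iff_has_vector_derivative)
  then show ?thesis
    by (simp only: set_integral_Icc_eq_Ioc)
qed

lemma set_integral_powr_scale:
  fixes f :: "real \<Rightarrow> real"
  assumes "0 < \<rho>" "0 < \<delta>"
  shows "(LBINT x:{\<delta><..}. x powr (a - 1) * f (x / \<rho>)) = \<rho> powr a * (LBINT x:{\<delta> / \<rho><..}. x powr (a - 1) * f x)"
proof -
  have "(LBINT x:{\<delta><..}. x powr (a - 1) * f (x / \<rho>))
      = \<rho> * (\<integral>x. indicator {\<delta><..} (\<rho> * x) * ((\<rho> * x) powr (a - 1) * f x) \<partial>lborel)"
    unfolding set_lebesgue_integral_def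
    using assms by (subst lborel_integral_real_affine[where c = \<rho> and t = 0]) auto
  also have "(\<integral>x. indicator {\<delta><..} (\<rho> * x) * ((\<rho> * x) powr (a - 1) * f x) \<partial>lborel)
     = (\<integral>x. \<rho> powr (a - 1) * (indicator {\<delta> / \<rho><..} x * (x powr (a - 1) * f x)) \<partial>lborel)"
  proof (intro Bochner_Integration.integral_cong refl)
    fix x
    have iff: "\<delta> / \<rho> < x \<longleftrightarrow> \<delta> < \<rho> * x"
      using assms by (simp add: field_simps)
    show "indicator {\<delta><..} (\<rho> * x) * ((\<rho> * x) powr (a - 1) * f x)
      = \<rho> powr (a - 1) * (indicator {\<delta> / \<rho><..} x * (x powr (a - 1) * f x))"
    proof (cases "\<delta> < \<rho> * x")
      case True
      then have "0 < x"
        using assms by (smt (verit) mult_nonneg_nonpos)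
      then show ?thesis
        using True iff assms by (simp add: powr_mult)
    qed (use iff in simp)
  qed
  also have "\<dots> = \<rho> powr (a - 1) * (LBINT x:{\<delta> / \<rho><..}. x powr (a - 1) * f x)"
    by (simp add: set_lebesgue_integral_def)
  also have "\<rho> * (\<rho> powr (a - 1) * (LBINT x:{\<delta> / \<rho><..}. x powr (a - 1) * f x))
     = \<rho> powr a * (LBINT x:{\<delta> / \<rho><..}. x powr (a - 1) * f x)"
    using assms by (simp add: powr_diff)
  finally show ?thesis .
qed

lemma abs_ln_at_right_0: "filterlim (\<lambda>\<delta>. \<bar>ln \<delta>\<bar> :: real) at_top (at_right 0)"
proof -
  have "filterlim (\<lambda>\<delta>. - ln \<delta> :: real) at_top (at_right 0)"
    using ln_at_0 by (simp add: filterlim_uminus_at_top)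
  then show ?thesis
    by (rule filterlim_at_top_mono) (auto intro: always_eventually)
qed

text \<open>The volume function \<open>w\<close> of a self-similar object reproduces itself under scaling up to an
error \<open>\<gamma>\<close>, the contribution of the generator.  On the logarithmic scale
\<open>renewal_eq\<close> is the renewal equation of the probability weights \<open>\<rho> i powr s\<close> at the
points \<open>- ln (\<rho> i)\<close>, for the function \<open>x powr (s - d) * w x\<close>, which
\<open>w_growth\<close> keeps bounded.\<close>

locale renewal =
  fixes I :: "'i set" and \<rho> :: "'i \<Rightarrow> real" and s d M B :: real and w \<gamma> :: "real \<Rightarrow> real"
  assumes finite_I: "finite I" and I_nonempty: "I \<noteq> {}"
    and ratio: "\<And>i. i \<in> I \<Longrightarrow> 0 < \<rho> i \<and> \<rho> i < 1"
    and moran: "(\<Sum>i\<in>I. \<rho> i powr s) = 1"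
    and s_less: "s < d"
    and w: "mono w" "\<And>x. 0 \<le> w x" "\<And>x. w x \<le> B"
    and \<gamma>: "mono \<gamma>" "\<And>x. 0 \<le> \<gamma> x"
    and \<gamma>_nonzero: "\<exists>x>0. 0 < \<gamma> x"
    and renewal_eq: "\<And>x. 0 < x \<Longrightarrow> w x = (\<Sum>i\<in>I. \<rho> i powr d * w (x / \<rho> i)) + \<gamma> x"
    and w_growth: "\<And>x. 0 < x \<Longrightarrow> w x \<le> M * x powr (d - s)"
begin

definition tail :: "real \<Rightarrow> real"
  where "tail \<delta> = (LBINT x:{\<delta><..}. x powr (s - d - 1) * w x)"

definition source :: real
  where "source = (LBINT x:{0<..}. x powr (s - d - 1) * \<gamma> x)"

text \<open>The mean step of the renewal process on the logarithmic scale.\<close>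

definition entropy :: real
  where "entropy = - (\<Sum>i\<in>I. \<rho> i powr s * ln (\<rho> i))"

definition window :: "real \<Rightarrow> real"
  where "window \<delta> = (\<Sum>i\<in>I. \<rho> i powr s * (tail \<delta> - tail (\<delta> / \<rho> i)))"

lemma \<gamma>_le_w: "0 < x \<Longrightarrow> \<gamma> x \<le> w x"
  using renewal_eq[of x] w(2) by (simp add: sum_nonneg)

lemma entropy_pos: "0 < entropy"
proof -
  have "0 < (\<Sum>i\<in>I. \<rho> i powr s * - ln (\<rho> i))"
  proof (intro sum_pos finite_I I_nonempty mult_pos_pos)
    show "0 < \<rho> i powr s" "0 < - ln (\<rho> i)" if "i \<in> I" for i
      using ratio[OF that] by auto
  qed
  then show ?thesis
    by (simp add: entropy_def sum_negf)
qed

lemma density_integrable: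
  assumes "mono f" "\<And>x. 0 \<le> f x" "\<And>x. 0 < x \<Longrightarrow> f x \<le> B" "0 < \<delta>"
  shows "set_integrable lborel {\<delta><..} (\<lambda>x. x powr (s - d - 1) * f x)"
proof (rule set_integrable_bound)
  have "0 \<le> B"
    using w(2,3) order_trans by blast
  show "set_integrable lborel {\<delta><..} (\<lambda>x. B * x powr (s - d - 1))"
    using s_less assms(4) by (intro set_integrable_mult_right set_integrable_powr_Ioi) auto
  have [measurable]: "f \<in> borel_measurable borel"
    using assms(1) by (rule borel_measurable_mono)
  show "set_borel_measurable lborel {\<delta><..} (\<lambda>x. x powr (s - d - 1) * f x)"
    unfolding set_borel_measurable_def by measurable
  show "AE x in lborel. x \<in> {\<delta><..} \<longrightarrow> norm (x powr (s - d - 1) * f x) \<le> norm (B * x powr (s - d - 1))"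
    using assms \<open>0 \<le> B\<close> by (intro AE_I2) (auto simp: abs_mult mult.commute intro!: mult_right_mono)
qed

lemmas w_integrable = density_integrable[OF w(1,2), OF w(3)]

lemma \<gamma>_tail_integrable: "0 < \<delta> \<Longrightarrow> set_integrable lborel {\<delta><..} (\<lambda>x. x powr (s - d - 1) * \<gamma> x)"
  using \<gamma>_le_w w(3) by (intro density_integrable \<gamma>) (auto intro: order_trans)

lemma w_dilated_integrable:
  assumes "0 < \<delta>" "i \<in> I"
  shows "set_integrable lborel {\<delta><..} (\<lambda>x. x powr (s - d - 1) * w (x / \<rho> i))"
proof (rule density_integrable)
  show "mono (\<lambda>x. w (x / \<rho> i))"
    using ratio[OF assms(2)] by (auto intro!: monoI monoD[OF w(1)] divide_right_mono)
qed (use assms w in auto)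

lemma tail_diff:
  assumes "0 < \<delta>" "\<delta> \<le> a"
  shows "(LBINT x:{\<delta><..a}. x powr (s - d - 1) * w x) = tail \<delta> - tail a"
proof -
  have "tail \<delta> = (LBINT x:{\<delta><..a} \<union> {a<..}. x powr (s - d - 1) * w x)"
    unfolding tail_def using assms by (intro arg_cong2[where f = "set_lebesgue_integral lborel"]) auto
  also have "\<dots> = (LBINT x:{\<delta><..a}. x powr (s - d - 1) * w x) + tail a"
    unfolding tail_def using assms
    by (intro set_integral_Un set_integrable_subset[OF w_integrable[of \<delta>]] w_integrable) auto
  finally show ?thesis
    by simp
qed

lemma tail_antimono: "0 < \<delta> \<Longrightarrow> \<delta> \<le> a \<Longrightarrow> tail a \<le> tail \<delta>"
  using tail_diff[of \<delta> a] w(2)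
    Bochner_Integration.integral_nonneg[of lborel "\<lambda>x. indicator {\<delta><..a} x *\<^sub>R (x powr (s - d - 1) * w x)"]
  by (simp add: set_lebesgue_integral_def)

lemma tail_nonneg: "0 \<le> tail \<delta>"
  unfolding tail_def set_lebesgue_integral_def using w(2) by (intro Bochner_Integration.integral_nonneg) auto

lemma tail_dilated:
  assumes "0 < \<delta>" "i \<in> I"
  shows "(LBINT x:{\<delta><..}. x powr (s - d - 1) * (\<rho> i powr d * w (x / \<rho> i))) = \<rho> i powr s * tail (\<delta> / \<rho> i)"
proof -
  have "(LBINT x:{\<delta><..}. x powr (s - d - 1) * (\<rho> i powr d * w (x / \<rho> i)))
      = \<rho> i powr d * (LBINT x:{\<delta><..}. x powr (s - d - 1) * w (x / \<rho> i))"
    by (simp add: mult.left_commute)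
  also have "\<dots> = \<rho> i powr d * (\<rho> i powr (s - d) * tail (\<delta> / \<rho> i))"
    using set_integral_powr_scale[of "\<rho> i" \<delta> "s - d" w] assms ratio by (simp add: tail_def)
  also have "\<dots> = \<rho> i powr s * tail (\<delta> / \<rho> i)"
    by (simp flip: powr_add)
  finally show ?thesis .
qed

text \<open>Integrating the renewal equation over \<open>x > \<delta>\<close>, where everything is integrable because
\<open>w\<close> is bounded and \<open>s < d\<close>, leaves on one side only the integral of \<open>w\<close> over the
bounded windows from \<open>\<delta>\<close> to \<open>\<delta> / \<rho> i\<close>.  All asymptotic statements below are read off
from this identity.\<close>

lemma source_tail_eq_window:
  assumes "0 < \<delta>"
  shows "(LBINT x:{\<delta><..}. x powr (s - d - 1) * \<gamma> x) = window \<delta>"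
proof -
  have int: "set_integrable lborel {\<delta><..} (\<lambda>x. x powr (s - d - 1) * (\<rho> i powr d * w (x / \<rho> i)))"
    if "i \<in> I" for i
    using w_dilated_integrable[OF assms that] by (simp add: mult.left_commute)
  have int_sum: "set_integrable lborel {\<delta><..} (\<lambda>x. \<Sum>i\<in>I. x powr (s - d - 1) * (\<rho> i powr d * w (x / \<rho> i)))"
    using int unfolding set_integrable_def scaleR_sum_right by (intro Bochner_Integration.integrable_sum) auto
  have "tail \<delta> = (LBINT x:{\<delta><..}. (\<Sum>i\<in>I. x powr (s - d - 1) * (\<rho> i powr d * w (x / \<rho> i)))
      + x powr (s - d - 1) * \<gamma> x)"
    unfolding tail_def using assms
    by (intro set_lebesgue_integral_cong)
       (auto simp: renewal_eq[of "_ :: real"] distrib_left sum_distrib_left)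
  also have "\<dots> = (LBINT x:{\<delta><..}. (\<Sum>i\<in>I. x powr (s - d - 1) * (\<rho> i powr d * w (x / \<rho> i))))
      + (LBINT x:{\<delta><..}. x powr (s - d - 1) * \<gamma> x)"
    by (intro set_integral_add int_sum \<gamma>_tail_integrable assms)
  also have "(LBINT x:{\<delta><..}. (\<Sum>i\<in>I. x powr (s - d - 1) * (\<rho> i powr d * w (x / \<rho> i))))
      = (\<Sum>i\<in>I. LBINT x:{\<delta><..}. x powr (s - d - 1) * (\<rho> i powr d * w (x / \<rho> i)))"
    using int unfolding set_lebesgue_integral_def set_integrable_def scaleR_sum_right
    by (intro Bochner_Integration.integral_sum) auto
  also have "\<dots> = (\<Sum>i\<in>I. \<rho> i powr s * tail (\<delta> / \<rho> i))"
    using assms by (intro sum.cong refl tail_dilated)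
  also have "tail \<delta> = (\<Sum>i\<in>I. \<rho> i powr s * tail \<delta>)"
    using moran by (simp flip: sum_distrib_right)
  finally show ?thesis
    by (simp add: window_def right_diff_distrib sum_subtractf)
qed

text \<open>The windows have total weighted logarithmic length \<open>entropy\<close>.\<close>

lemma window_le:
  assumes "0 < \<delta>" "\<And>i x. i \<in> I \<Longrightarrow> \<delta> \<le> x \<Longrightarrow> x \<le> \<delta> / \<rho> i \<Longrightarrow> x powr (s - d) * w x \<le> b"
  shows "window \<delta> \<le> entropy * b"
proof -
  have "tail \<delta> - tail (\<delta> / \<rho> i) \<le> b * - ln (\<rho> i)" if i: "i \<in> I" for i
  proof -
    have \<delta>: "\<delta> \<le> \<delta> / \<rho> i" "0 < \<delta> / \<rho> i"
      using ratio[OF i] assms(1) by (auto simp: field_simps)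
    have "(LBINT x:{\<delta><..\<delta> / \<rho> i}. x powr (s - d - 1) * w x) \<le> (LBINT x:{\<delta><..\<delta> / \<rho> i}. b * (1 / x))"
    proof (rule set_integral_mono)
      show "set_integrable lborel {\<delta><..\<delta> / \<rho> i} (\<lambda>x. x powr (s - d - 1) * w x)"
        using w_integrable[OF assms(1)] by (rule set_integrable_subset) auto
      show "set_integrable lborel {\<delta><..\<delta> / \<rho> i} (\<lambda>x. b * (1 / x))"
        using assms(1) by (intro set_integrable_mult_right set_integrable_inverse_Ioc) auto
      show "x powr (s - d - 1) * w x \<le> b * (1 / x)" if "x \<in> {\<delta><..\<delta> / \<rho> i}" for x
        using assms(2)[OF i, of x] that assms(1) powr_diff[of x "s - d" 1]
        by (simp add: divide_right_mono)
    qed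
    also have "\<dots> = b * (ln (\<delta> / \<rho> i) - ln \<delta>)"
      using assms(1) \<delta> by (simp only: set_integral_mult_right set_integral_inverse_Ioc)
    also have "\<dots> = b * - ln (\<rho> i)"
      using assms(1) ratio[OF i] by (simp add: ln_div)
    finally show ?thesis
      using tail_diff[OF assms(1) \<delta>(1)] by simp
  qed
  then have "window \<delta> \<le> (\<Sum>i\<in>I. \<rho> i powr s * (b * - ln (\<rho> i)))"
    unfolding window_def by (intro sum_mono mult_left_mono) auto
  also have "\<dots> = entropy * b"
    by (simp add: entropy_def sum_distrib_left sum_distrib_right sum_negf mult_ac)
  finally show ?thesis .
qed

lemma window_ge:
  assumes "0 < \<delta>" "\<And>i x. i \<in> I \<Longrightarrow> \<delta> \<le> x \<Longrightarrow> x \<le> \<delta> / \<rho> i \<Longrightarrow> b \<le> x powr (s - d) * w x"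
  shows "entropy * b \<le> window \<delta>"
proof -
  have "b * - ln (\<rho> i) \<le> tail \<delta> - tail (\<delta> / \<rho> i)" if i: "i \<in> I" for i
  proof -
    have \<delta>: "\<delta> \<le> \<delta> / \<rho> i" "0 < \<delta> / \<rho> i"
      using ratio[OF i] assms(1) by (auto simp: field_simps)
    have "b * - ln (\<rho> i) = b * (ln (\<delta> / \<rho> i) - ln \<delta>)"
      using assms(1) ratio[OF i] by (simp add: ln_div)
    also have "\<dots> = (LBINT x:{\<delta><..\<delta> / \<rho> i}. b * (1 / x))"
      using assms(1) \<delta> by (simp only: set_integral_mult_right set_integral_inverse_Ioc)
    also have "\<dots> \<le> (LBINT x:{\<delta><..\<delta> / \<rho> i}. x powr (s - d - 1) * w x)"
    proof (rule set_integral_mono)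
      show "set_integrable lborel {\<delta><..\<delta> / \<rho> i} (\<lambda>x. x powr (s - d - 1) * w x)"
        using w_integrable[OF assms(1)] by (rule set_integrable_subset) auto
      show "set_integrable lborel {\<delta><..\<delta> / \<rho> i} (\<lambda>x. b * (1 / x))"
        using assms(1) by (intro set_integrable_mult_right set_integrable_inverse_Ioc) auto
      show "b * (1 / x) \<le> x powr (s - d - 1) * w x" if "x \<in> {\<delta><..\<delta> / \<rho> i}" for x
        using assms(2)[OF i, of x] that assms(1) powr_diff[of x "s - d" 1]
        by (simp add: divide_right_mono)
    qed
    finally show ?thesis
      using tail_diff[OF assms(1) \<delta>(1)] by simp
  qed
  then have "(\<Sum>i\<in>I. \<rho> i powr s * (b * - ln (\<rho> i))) \<le> window \<delta>"
    unfolding window_def by (intro sum_mono mult_left_mono) auto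
  moreover have "(\<Sum>i\<in>I. \<rho> i powr s * (b * - ln (\<rho> i))) = entropy * b"
    by (simp add: entropy_def sum_distrib_left sum_distrib_right sum_negf mult_ac)
  ultimately show ?thesis
    by simp
qed

lemma window_bounded:
  assumes "0 < \<delta>"
  shows "window \<delta> \<le> entropy * M"
proof (rule window_le[OF assms])
  fix x assume "\<delta> \<le> x"
  then have "0 < x"
    using assms by simp
  then show "x powr (s - d) * w x \<le> M"
    using w_growth[of x] by (simp add: powr_diff field_simps)
qed

text \<open>The growth bound on \<open>w\<close> bounds the windows, hence the tail integrals of \<open>\<gamma>\<close>, uniformly.\<close>

lemma source_integrable: "set_integrable lborel {0<..} (\<lambda>x. x powr (s - d - 1) * \<gamma> x)"
proof -
  define t where "t n = inverse (real (Suc n))" for n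
  define f where "f n x = indicator {t n<..} x *\<^sub>R (x powr (s - d - 1) * \<gamma> x)" for n x
  have t: "0 < t n" "m \<le> n \<Longrightarrow> t n \<le> t m" for m n
    by (auto simp: t_def field_simps)
  have [measurable]: "\<gamma> \<in> borel_measurable borel"
    using \<gamma>(1) by (rule borel_measurable_mono)
  have mono: "mono (\<lambda>n. f n x)" for x
    unfolding f_def using t(2) \<gamma>(2)
    by (intro monoI) (auto split: split_indicator intro: order.strict_trans1)
  have int: "integrable lborel (f n)" for n
    using \<gamma>_tail_integrable[OF t(1), of n] by (simp add: set_integrable_def f_def[abs_def])
  have f_int: "integral\<^sup>L lborel (f n) = window (t n)" for n
    using source_tail_eq_window[OF t(1), of n] by (simp add: set_lebesgue_integral_def f_def[abs_def])
  have "incseq (\<lambda>n. window (t n))"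
    unfolding f_int[symmetric] using int mono by (intro monoI integral_mono) (auto simp: mono_def)
  then obtain l where l: "(\<lambda>n. window (t n)) \<longlonglongrightarrow> l"
    by (rule incseq_convergent[of "\<lambda>n. window (t n)" "entropy * M"]) (use window_bounded[OF t(1)] in auto)
  show ?thesis
    unfolding set_integrable_def
  proof (rule integrable_monotone_convergence)
    show "AE x in lborel. (\<lambda>n. f n x) \<longlonglongrightarrow> indicat_real {0<..} x *\<^sub>R (x powr (s - d - 1) * \<gamma> x)"
    proof (intro AE_I2)
      fix x :: real
      have "t \<longlonglongrightarrow> 0"
        unfolding t_def by (rule LIMSEQ_inverse_real_of_nat)
      then have lt: "\<forall>\<^sub>F n in sequentially. t n < x" if "0 < x"
        using that by (rule order_tendstoD)
      have "\<forall>\<^sub>F n in sequentially. f n x = indicat_real {0<..} x *\<^sub>R (x powr (s - d - 1) * \<gamma> x)"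
      proof (cases "0 < x")
        case True
        then show ?thesis
          using eventually_mono[OF lt[OF True], of "\<lambda>n. f n x = indicat_real {0<..} x *\<^sub>R (x powr (s - d - 1) * \<gamma> x)"]
          by (simp add: f_def)
      next
        case False
        then have "\<not> t n < x" for n
          using t(1)[of n] by linarith
        then show ?thesis
          using False by (simp add: f_def)
      qed
      then show "(\<lambda>n. f n x) \<longlonglongrightarrow> indicat_real {0<..} x *\<^sub>R (x powr (s - d - 1) * \<gamma> x)"
        by (rule tendsto_eventually)
    qed
    show "(\<lambda>n. integral\<^sup>L lborel (f n)) \<longlonglongrightarrow> l"
      using l by (simp add: f_int)
    show "integrable lborel (f n)" for n
      by (rule int)
    show "AE x in lborel. mono (\<lambda>n. f n x)"
      by (intro AE_I2 mono)
  qed measurable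
qed

lemma source_pos: "0 < source"
proof -
  obtain y where y: "0 < y" "0 < \<gamma> y"
    using \<gamma>_nonzero by auto
  define c where "c = (2 * y) powr (s - d - 1) * \<gamma> y"
  have c: "0 < c"
    using y by (simp add: c_def)
  have "(LBINT x:{y<..2*y}. c) \<le> source"
    unfolding source_def set_lebesgue_integral_def
  proof (rule integral_mono)
    have "emeasure lborel {y<..2*y} < \<infinity>"
      using y by simp
    then show "integrable lborel (\<lambda>x. indicat_real {y<..2 * y} x *\<^sub>R c)"
      by (intro integrable_scaleR_left integrable_real_indicator) auto
    show "integrable lborel (\<lambda>x. indicat_real {0<..} x *\<^sub>R (x powr (s - d - 1) * \<gamma> x))"
      using source_integrable by (simp add: set_integrable_def)
    show "indicat_real {y<..2 * y} x *\<^sub>R c \<le> indicat_real {0<..} x *\<^sub>R (x powr (s - d - 1) * \<gamma> x)" for x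
    proof (cases "x \<in> {y<..2*y}")
      case True
      then have "c \<le> x powr (s - d - 1) * \<gamma> x"
        unfolding c_def using y s_less \<gamma>
        by (intro mult_mono powr_mono2' monoD[OF \<gamma>(1)]) auto
      then show ?thesis
        using True y by simp
    next
      case False
      then have "indicat_real {y<..2 * y} x = 0"
        by (rule indicator_simps)
      then show ?thesis
        using \<gamma>(2)[of x] by simp
    qed
  qed
  moreover have "(LBINT x:{y<..2*y}. c) = y * c"
    using y by (simp add: set_lebesgue_integral_def)
  ultimately show ?thesis
    using y c by (smt (verit) mult_pos_pos)
qed

lemma window_tendsto: "(window \<longlongrightarrow> source) (at_right 0)"
proof (rule tendsto_at_right_sequentially[of 0 1])
  fix S :: "nat \<Rightarrow> real"
  assume S: "\<And>n. 0 < S n" "\<And>n. S n < 1" "decseq S" "S \<longlonglongrightarrow> 0"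
  have eq: "(\<Union>n. {S n<..}) = {0<..}"
  proof safe
    fix x n assume "S n < x"
    with S(1)[of n] show "0 < x"
      by simp
  next
    fix x :: real assume "0 < x"
    with order_tendstoD(2)[OF S(4)] show "x \<in> (\<Union>n. {S n<..})"
      by (force simp: eventually_sequentially)
  qed
  have "(\<lambda>n. LBINT x:{S n<..}. x powr (s - d - 1) * \<gamma> x) \<longlonglongrightarrow> (LBINT x:(\<Union>n. {S n<..}). x powr (s - d - 1) * \<gamma> x)"
    using S(3) source_integrable unfolding eq[symmetric]
    by (intro set_integral_cont_up) (auto simp: incseq_def decseq_def intro: order.strict_trans1)
  then show "(\<lambda>n. window (S n)) \<longlonglongrightarrow> source"
    using S(1) by (simp add: eq source_def source_tail_eq_window)
qed simp

lemma min_ratio: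
  obtains b where "0 < b" "b < 1" "\<And>i. i \<in> I \<Longrightarrow> b \<le> \<rho> i"
proof
  show "0 < Min (\<rho> ` I)" "Min (\<rho> ` I) < 1" "\<And>i. i \<in> I \<Longrightarrow> Min (\<rho> ` I) \<le> \<rho> i"
    using finite_I I_nonempty ratio by (auto simp: Min_less_iff)
qed

text \<open>The function \<open>tail \<delta> + c * ln \<delta>\<close> equals the weighted mean of its values at the points
\<open>\<delta> / \<rho> i\<close> up to an error that tends to zero, provided that \<open>c = source / entropy\<close>.
The maximum principle then shows that it grows more slowly than any multiple of \<open>\<bar>ln \<delta>\<bar>\<close>.\<close>

lemma tail_over_log_tendsto:
  "((\<lambda>\<delta>. tail \<delta> / \<bar>ln \<delta>\<bar>) \<longlongrightarrow> source / entropy) (at_right 0)"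
proof -
  define c where "c = source / entropy"
  define \<psi> where "\<psi> \<delta> = tail \<delta> + c * ln \<delta>" for \<delta>
  have \<psi>_window: "\<psi> \<delta> = (\<Sum>i\<in>I. \<rho> i powr s * \<psi> (\<delta> / \<rho> i)) + (window \<delta> - source)" if "0 < \<delta>" for \<delta>
  proof -
    have "(\<Sum>i\<in>I. \<rho> i powr s * \<psi> (\<delta> / \<rho> i))
       = (\<Sum>i\<in>I. \<rho> i powr s * \<psi> \<delta> - \<rho> i powr s * (tail \<delta> - tail (\<delta> / \<rho> i)) - c * (\<rho> i powr s * ln (\<rho> i)))"
    proof (intro sum.cong refl)
      fix i assume "i \<in> I"
      then have "ln (\<delta> / \<rho> i) = ln \<delta> - ln (\<rho> i)"
        using ratio[of i] that by (simp add: ln_div)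
      then show "\<rho> i powr s * \<psi> (\<delta> / \<rho> i)
          = \<rho> i powr s * \<psi> \<delta> - \<rho> i powr s * (tail \<delta> - tail (\<delta> / \<rho> i)) - c * (\<rho> i powr s * ln (\<rho> i))"
        unfolding \<psi>_def \<open>ln (\<delta> / \<rho> i) = ln \<delta> - ln (\<rho> i)\<close> by (simp add: algebra_simps)
    qed
    also have "\<dots> = \<psi> \<delta> - window \<delta> + c * entropy"
      using moran
      by (simp add: sum_subtractf window_def entropy_def flip: sum_distrib_left sum_distrib_right)
    also have "c * entropy = source"
      using entropy_pos by (simp add: c_def)
    finally show ?thesis
      by simp
  qed
  obtain b where b: "0 < b" "b < 1" "\<And>i. i \<in> I \<Longrightarrow> b \<le> \<rho> i"
    by (rule min_ratio) blast
  have bound: "\<exists>C\<ge>0. \<exists>\<alpha>>0. \<forall>\<delta>. 0 < \<delta> \<and> \<delta> < \<alpha> \<longrightarrow> \<bar>\<psi> \<delta>\<bar> \<le> C + \<kappa> * \<bar>ln \<delta>\<bar>" if \<kappa>: "0 < \<kappa>" for \<kappa>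
  proof -
    have "\<forall>\<^sub>F \<delta> in at_right 0. dist (window \<delta>) source < \<kappa> * entropy"
      using window_tendsto entropy_pos \<kappa> by (intro tendstoD) auto
    then obtain \<alpha>0 where \<alpha>0: "0 < \<alpha>0" "\<And>\<delta>. 0 < \<delta> \<Longrightarrow> \<delta> < \<alpha>0 \<Longrightarrow> dist (window \<delta>) source < \<kappa> * entropy"
      by (auto simp: eventually_at_right_field)
    define \<alpha> where "\<alpha> = min \<alpha>0 1"
    have \<alpha>: "0 < \<alpha>" "\<alpha> \<le> 1" "\<And>\<delta>. 0 < \<delta> \<Longrightarrow> \<delta> < \<alpha> \<Longrightarrow> \<bar>window \<delta> - source\<bar> \<le> \<kappa> * entropy"
      using \<alpha>0 by (auto simp: \<alpha>_def dist_real_def less_imp_le)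
    \<comment> \<open>The term \<open>\<kappa> * ln \<delta>\<close> gains \<open>\<kappa> * entropy\<close> in one step, which pays for the error.\<close>
    define u where "u \<delta> = \<bar>\<psi> \<delta>\<bar> + \<kappa> * ln \<delta>" for \<delta>
    define l where "l = \<bar>ln \<alpha>\<bar> + \<bar>ln (\<alpha> / b)\<bar>"
    define C where "C = tail \<alpha> + \<bar>c\<bar> * l + \<kappa> * l"
    have l: "0 \<le> l"
      by (simp add: l_def)
    have C: "0 \<le> C"
      using tail_nonneg l \<kappa> by (simp add: C_def)
    have u_le: "u \<delta> \<le> C" if "0 < \<delta>" "\<delta> \<le> \<alpha> / b" for \<delta>
    proof (rule scaling_maximum_principle[where I = I and \<rho> = \<rho> and b = b and \<alpha> = \<alpha>
          and p = "\<lambda>i. \<rho> i powr s" and u = u, OF finite_I _ b(1) _ _ C _ _ that])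
      show "b \<le> \<rho> i \<and> \<rho> i < 1" if "i \<in> I" for i
        using b(3) ratio that by auto
      show "u \<delta> \<le> C" if \<delta>: "\<alpha> \<le> \<delta>" "\<delta> \<le> \<alpha> / b" for \<delta>
      proof -
        have "ln \<alpha> \<le> ln \<delta>" "ln \<delta> \<le> ln (\<alpha> / b)"
          using \<delta> \<alpha> b by simp_all
        then have ln: "\<bar>ln \<delta>\<bar> \<le> l"
          by (simp add: l_def)
        have "\<bar>\<psi> \<delta>\<bar> \<le> \<bar>tail \<delta>\<bar> + \<bar>c\<bar> * \<bar>ln \<delta>\<bar>"
          unfolding \<psi>_def by (metis abs_mult abs_triangle_ineq)
        also have "\<dots> \<le> tail \<alpha> + \<bar>c\<bar> * l"
          using tail_antimono[OF \<alpha>(1) \<delta>(1)] tail_nonneg ln by (intro add_mono mult_left_mono) auto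
        finally have "\<bar>\<psi> \<delta>\<bar> \<le> tail \<alpha> + \<bar>c\<bar> * l" .
        moreover have "\<kappa> * ln \<delta> \<le> \<kappa> * l"
          using ln \<kappa> by (intro mult_left_mono) auto
        ultimately show ?thesis
          by (simp add: u_def C_def)
      qed
      show "u \<delta> \<le> (\<Sum>i\<in>I. \<rho> i powr s * u (\<delta> / \<rho> i))" if \<delta>: "0 < \<delta>" "\<delta> < \<alpha>" for \<delta>
      proof -
        have "\<bar>\<psi> \<delta>\<bar> \<le> \<bar>\<Sum>i\<in>I. \<rho> i powr s * \<psi> (\<delta> / \<rho> i)\<bar> + \<bar>window \<delta> - source\<bar>"
          unfolding \<psi>_window[OF \<delta>(1)] by (rule abs_triangle_ineq)
        also have "\<dots> \<le> (\<Sum>i\<in>I. \<bar>\<rho> i powr s * \<psi> (\<delta> / \<rho> i)\<bar>) + \<kappa> * entropy"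
          using \<alpha>(3)[OF \<delta>] by (intro add_mono sum_abs)
        finally have le: "\<bar>\<psi> \<delta>\<bar> \<le> (\<Sum>i\<in>I. \<rho> i powr s * \<bar>\<psi> (\<delta> / \<rho> i)\<bar>) + \<kappa> * entropy"
          by (simp add: abs_mult)
        have "(\<Sum>i\<in>I. \<rho> i powr s * u (\<delta> / \<rho> i))
           = (\<Sum>i\<in>I. \<rho> i powr s * \<bar>\<psi> (\<delta> / \<rho> i)\<bar> + \<rho> i powr s * (\<kappa> * ln \<delta>) - \<kappa> * (\<rho> i powr s * ln (\<rho> i)))"
        proof (intro sum.cong refl)
          fix i assume "i \<in> I"
          then have "ln (\<delta> / \<rho> i) = ln \<delta> - ln (\<rho> i)"
            using ratio[of i] \<delta> by (simp add: ln_div)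
          then show "\<rho> i powr s * u (\<delta> / \<rho> i)
             = \<rho> i powr s * \<bar>\<psi> (\<delta> / \<rho> i)\<bar> + \<rho> i powr s * (\<kappa> * ln \<delta>) - \<kappa> * (\<rho> i powr s * ln (\<rho> i))"
            unfolding u_def \<open>ln (\<delta> / \<rho> i) = ln \<delta> - ln (\<rho> i)\<close> by (simp add: algebra_simps)
        qed
        also have "\<dots> = (\<Sum>i\<in>I. \<rho> i powr s * \<bar>\<psi> (\<delta> / \<rho> i)\<bar>) + \<kappa> * ln \<delta> + \<kappa> * entropy"
          using moran
          by (simp add: sum_subtractf sum.distrib entropy_def flip: sum_distrib_left sum_distrib_right)
        finally show ?thesis
          using le by (simp add: u_def)
      qed
    qed (use moran in auto)
    have "\<bar>\<psi> \<delta>\<bar> \<le> C + \<kappa> * \<bar>ln \<delta>\<bar>" if "0 < \<delta>" "\<delta> < \<alpha>" for \<delta>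
    proof -
      have "\<alpha> \<le> \<alpha> / b"
        using b \<alpha> by (simp add: field_simps)
      then have "u \<delta> \<le> C"
        using u_le that by simp
      moreover have "\<bar>ln \<delta>\<bar> = - ln \<delta>"
        using that \<alpha> by simp
      ultimately show ?thesis
        by (simp add: u_def)
    qed
    then show ?thesis
      using C \<alpha>(1) by blast
  qed
  show ?thesis
  proof (rule tendstoI)
    fix e :: real assume e: "0 < e"
    obtain C \<alpha> where C: "0 \<le> C" "0 < \<alpha>" "\<And>\<delta>. 0 < \<delta> \<Longrightarrow> \<delta> < \<alpha> \<Longrightarrow> \<bar>\<psi> \<delta>\<bar> \<le> C + e / 2 * \<bar>ln \<delta>\<bar>"
      using bound[of "e / 2"] e by auto
    have "\<forall>\<^sub>F \<delta> in at_right 0. 2 * C / e + 1 < \<bar>ln \<delta>\<bar>"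
      using abs_ln_at_right_0 by (auto simp: filterlim_at_top_dense)
    moreover have "\<forall>\<^sub>F \<delta> in at_right (0::real). \<delta> < min \<alpha> 1"
      using C(2) by (intro eventually_at_right_real[of 0 "min \<alpha> 1", THEN eventually_mono]) auto
    moreover have "\<forall>\<^sub>F \<delta> in at_right (0::real). 0 < \<delta>"
      by (simp add: eventually_at_right_less)
    ultimately show "\<forall>\<^sub>F \<delta> in at_right 0. dist (tail \<delta> / \<bar>ln \<delta>\<bar>) (source / entropy) < e"
    proof eventually_elim
      case (elim \<delta>)
      have pos: "0 < \<bar>ln \<delta>\<bar>"
        using elim(1) C(1) e by (smt (verit) divide_nonneg_pos)
      have "tail \<delta> / \<bar>ln \<delta>\<bar> - c = \<psi> \<delta> / \<bar>ln \<delta>\<bar>"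
        using pos elim by (simp add: \<psi>_def field_simps)
      then have "dist (tail \<delta> / \<bar>ln \<delta>\<bar>) c = \<bar>\<psi> \<delta>\<bar> / \<bar>ln \<delta>\<bar>"
        by (simp add: dist_real_def)
      also have "\<dots> \<le> (C + e / 2 * \<bar>ln \<delta>\<bar>) / \<bar>ln \<delta>\<bar>"
        using C(3)[of \<delta>] elim by (intro divide_right_mono) simp_all
      also have "\<dots> < e"
      proof -
        have "2 * C / e < \<bar>ln \<delta>\<bar>"
          using elim(1) by simp
        then have "C < e / 2 * \<bar>ln \<delta>\<bar>"
          using e by (simp add: field_simps)
        then show ?thesis
          using pos by (simp add: field_simps)
      qed
      finally show ?case
        by (simp add: c_def)
    qed
  qed
qed

lemma average_tendsto:
  "((\<lambda>\<delta>. 1 / \<bar>ln \<delta>\<bar> * (LBINT x:{\<delta>..1}. x powr (s - d) * w x / x)) \<longlongrightarrow> source / entropy) (at_right 0)"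
proof (rule Lim_transform_eventually)
  have "((\<lambda>\<delta>. tail 1 / \<bar>ln \<delta>\<bar>) \<longlongrightarrow> 0) (at_right 0)"
    by (rule tendsto_divide_0[OF tendsto_const filterlim_at_top_imp_at_infinity[OF abs_ln_at_right_0]])
  then show "((\<lambda>\<delta>. tail \<delta> / \<bar>ln \<delta>\<bar> - tail 1 / \<bar>ln \<delta>\<bar>) \<longlongrightarrow> source / entropy) (at_right 0)"
    using tendsto_diff[OF tail_over_log_tendsto] by fastforce
  have "\<forall>\<^sub>F \<delta> in at_right (0::real). \<delta> < 1 \<and> 0 < \<delta>"
    by (intro eventually_conj eventually_at_right_less eventually_at_right_real[of 0 1, THEN eventually_mono]) auto
  then show "\<forall>\<^sub>F \<delta> in at_right 0. tail \<delta> / \<bar>ln \<delta>\<bar> - tail 1 / \<bar>ln \<delta>\<bar>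
      = 1 / \<bar>ln \<delta>\<bar> * (LBINT x:{\<delta>..1}. x powr (s - d) * w x / x)"
  proof eventually_elim
    case (elim \<delta>)
    have "(LBINT x:{\<delta>..1}. x powr (s - d) * w x / x) = (LBINT x:{\<delta>..1}. x powr (s - d - 1) * w x)"
    proof (intro set_lebesgue_integral_cong allI impI)
      fix x assume "x \<in> {\<delta>..1}"
      then have "0 < x"
        using elim by simp
      then show "x powr (s - d) * w x / x = x powr (s - d - 1) * w x"
        using powr_diff[of x "s - d" 1] by simp
    qed simp
    also have "\<dots> = tail \<delta> - tail 1"
      using elim by (simp add: set_integral_Icc_eq_Ioc tail_diff)
    finally show ?case
      by (simp add: diff_divide_distrib)
  qed
qed

lemma window_interval_eventually:
  assumes "\<forall>\<^sub>F x in at_right (0::real). P x"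
  shows "\<forall>\<^sub>F \<delta> in at_right 0. 0 < \<delta> \<and> (\<forall>i\<in>I. \<forall>x. \<delta> \<le> x \<and> x \<le> \<delta> / \<rho> i \<longrightarrow> P x)"
proof -
  obtain b where b: "0 < b" "b < 1" "\<And>i. i \<in> I \<Longrightarrow> b \<le> \<rho> i"
    by (rule min_ratio) blast
  obtain \<alpha> where \<alpha>: "0 < \<alpha>" "\<And>x. 0 < x \<Longrightarrow> x < \<alpha> \<Longrightarrow> P x"
    using assms by (auto simp: eventually_at_right_field)
  have "0 < \<delta> \<and> (\<forall>i\<in>I. \<forall>x. \<delta> \<le> x \<and> x \<le> \<delta> / \<rho> i \<longrightarrow> P x)" if "0 < \<delta>" "\<delta> < \<alpha> * b" for \<delta>
  proof (intro conjI ballI allI impI)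
    fix i x assume "i \<in> I" and x: "\<delta> \<le> x \<and> x \<le> \<delta> / \<rho> i"
    then have "\<delta> / \<rho> i \<le> \<delta> / b"
      using b that(1) by (intro divide_left_mono) (auto intro: mult_pos_pos order.strict_trans2)
    also have "\<dots> < \<alpha>"
      using that b by (simp add: field_simps)
    finally show "P x"
      using x that(1) by (intro \<alpha>(2)) auto
  qed fact
  then show ?thesis
    using \<alpha>(1) b(1) by (auto simp: eventually_at_right_field intro!: exI[of _ "\<alpha> * b"])
qed

text \<open>If the rescaled function converges to \<open>m\<close>, then the windows converge to \<open>entropy * m\<close>.\<close>

lemma limit_eq_average:
  assumes "((\<lambda>x. x powr (s - d) * w x) \<longlongrightarrow> m) (at_right 0)"
  shows "m = source / entropy"
proof (rule antisym)
  show "m \<le> source / entropy"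
  proof (rule dense_le)
    fix b assume "b < m"
    then have "\<forall>\<^sub>F x in at_right 0. b < x powr (s - d) * w x"
      using assms by (rule order_tendstoD(1)[rotated])
    from window_interval_eventually[OF this] have "\<forall>\<^sub>F \<delta> in at_right 0. entropy * b \<le> window \<delta>"
      by eventually_elim (auto intro!: window_ge intro: less_imp_le)
    then have "entropy * b \<le> source"
      by (intro tendsto_lowerbound[OF window_tendsto]) auto
    then show "b \<le> source / entropy"
      using entropy_pos by (simp add: field_simps)
  qed
  show "source / entropy \<le> m"
  proof (rule dense_ge)
    fix b assume "m < b"
    then have "\<forall>\<^sub>F x in at_right 0. x powr (s - d) * w x < b"
      using assms by (rule order_tendstoD(2)[rotated])
    from window_interval_eventually[OF this] have "\<forall>\<^sub>F \<delta> in at_right 0. window \<delta> \<le> entropy * b"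
      by eventually_elim (auto intro!: window_le intro: less_imp_le)
    then have "source \<le> entropy * b"
      by (intro tendsto_upperbound[OF window_tendsto]) auto
    then show "source / entropy \<le> b"
      using entropy_pos by (simp add: field_simps)
  qed
qed

text \<open>The windows tend to the positive number \<open>source\<close>, and by monotonicity the value of \<open>w\<close>
at a point beyond all windows bounds their integrals from above.\<close>

lemma w_growth_lower: "\<exists>c>0. \<forall>\<^sub>F x in at_right 0. c * x powr (d - s) \<le> w x"
proof -
  obtain b where b: "0 < b" "b < 1" "\<And>i. i \<in> I \<Longrightarrow> b \<le> \<rho> i"
    by (rule min_ratio) blast
  have "\<forall>\<^sub>F \<delta> in at_right 0. source / 2 < window \<delta>"
    using source_pos by (intro order_tendstoD(1)[OF window_tendsto]) simp
  then obtain \<alpha> where \<alpha>: "0 < \<alpha>" "\<And>x. 0 < x \<Longrightarrow> x < \<alpha> \<Longrightarrow> source / 2 < window x"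
    by (auto simp: eventually_at_right_field)
  define c where "c = source / 2 / entropy * b powr (d - s)"
  have "c * x powr (d - s) \<le> w x" if x: "0 < x" "x < \<alpha>" for x
  proof -
    have bx: "0 < b * x" "b * x < \<alpha>"
      using b x by (auto intro: less_trans[of _ "1 * x"])
    have "window (b * x) \<le> entropy * ((b * x) powr (s - d) * w x)"
    proof (rule window_le[OF bx(1)])
      fix i y assume "i \<in> I" and y: "b * x \<le> y" "y \<le> b * x / \<rho> i"
      have "b * x / \<rho> i \<le> x"
        using b(3)[OF \<open>i \<in> I\<close>] b(1) x(1) ratio[OF \<open>i \<in> I\<close>] by (simp add: field_simps)
      then show "y powr (s - d) * w y \<le> (b * x) powr (s - d) * w x"
        using y bx s_less w(2) by (intro mult_mono powr_mono2' monoD[OF w(1)]) auto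
    qed
    with \<alpha>(2)[OF bx] have "source / 2 / entropy \<le> (b * x) powr (s - d) * w x"
      using entropy_pos by (simp add: field_simps)
    then have "source / 2 / entropy * (b * x) powr (d - s) \<le> (b * x) powr (s - d) * w x * (b * x) powr (d - s)"
      by (intro mult_right_mono) auto
    also have "\<dots> = w x * ((b * x) powr (s - d) * (b * x) powr (d - s))"
      by (simp add: mult_ac)
    also have "(b * x) powr (s - d) * (b * x) powr (d - s) = 1"
      using bx b x by (simp flip: powr_add)
    finally show ?thesis
      using b x by (simp add: c_def powr_mult mult_ac)
  qed
  moreover have "0 < c"
    using source_pos entropy_pos b by (simp add: c_def)
  ultimately show ?thesis
    using \<alpha>(1) by (intro exI[of _ c]) (auto simp: eventually_at_right_field)
qed

text \<open>On \<open>{0<..g}\<close> the difference exceeds \<open>\<gamma>\<close> by the terms with \<open>x > \<rho> i * g\<close>.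
Rescaled, their integrals form the window at \<open>g\<close>, which is the missing part of the integral of
\<open>\<gamma>\<close>.\<close>

lemma truncated_difference:
  assumes g: "0 < g"
  defines "h \<equiv> (\<lambda>x. w x - (\<Sum>i\<in>I. indicator {0<..\<rho> i * g} x * (\<rho> i powr d * w (x / \<rho> i))))"
  shows "set_integrable lborel {0<..g} (\<lambda>x. x powr (s - d - 1) * h x)" (is ?int)
    and "(LBINT x:{0<..g}. x powr (s - d - 1) * h x) = source" (is ?eq)
proof -
  define k where "k i x = x powr (s - d - 1) * (\<rho> i powr d * w (x / \<rho> i))" for i x
  have k_int: "set_integrable lborel {\<delta><..} (k i)" if "0 < \<delta>" "i \<in> I" for \<delta> i
    using w_dilated_integrable[OF that] by (simp add: k_def[abs_def] mult.left_commute)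
  have \<rho>g: "0 < \<rho> i * g" "\<rho> i * g \<le> g" if "i \<in> I" for i
    using ratio[OF that] g by auto
  have k_integral: "(LBINT x:{\<rho> i * g<..g}. k i x) = \<rho> i powr s * (tail g - tail (g / \<rho> i))" if i: "i \<in> I" for i
  proof -
    have "(LBINT x:{\<rho> i * g<..}. k i x) = (LBINT x:{\<rho> i * g<..g} \<union> {g<..}. k i x)"
      using \<rho>g[OF i] by (intro arg_cong2[where f = "set_lebesgue_integral lborel"]) auto
    also have "\<dots> = (LBINT x:{\<rho> i * g<..g}. k i x) + (LBINT x:{g<..}. k i x)"
      using i g by (intro set_integral_Un set_integrable_subset[OF k_int[OF \<rho>g(1)[OF i] i]] k_int) auto
    finally show ?thesis
      using tail_dilated[OF \<rho>g(1)[OF i] i] tail_dilated[OF g i] ratio[OF i]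
      by (simp add: k_def right_diff_distrib)
  qed
  have h: "indicat_real {0<..g} x *\<^sub>R (x powr (s - d - 1) * h x)
     = indicat_real {0<..g} x *\<^sub>R (x powr (s - d - 1) * \<gamma> x) + (\<Sum>i\<in>I. indicat_real {\<rho> i * g<..g} x *\<^sub>R k i x)" for x
  proof (cases "x \<in> {0<..g}")
    case True
    then have "w x = (\<Sum>i\<in>I. \<rho> i powr d * w (x / \<rho> i)) + \<gamma> x"
      using renewal_eq by simp
    then have "h x = \<gamma> x + (\<Sum>i\<in>I. \<rho> i powr d * w (x / \<rho> i) - indicator {0<..\<rho> i * g} x * (\<rho> i powr d * w (x / \<rho> i)))"
      by (simp add: h_def sum_subtractf)
    also have "\<dots> = \<gamma> x + (\<Sum>i\<in>I. indicat_real {\<rho> i * g<..g} x * (\<rho> i powr d * w (x / \<rho> i)))"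
      using True by (intro arg_cong2[where f = "(+)"] sum.cong refl) (auto simp: indicator_def)
    finally show ?thesis
      using True by (simp add: k_def distrib_left sum_distrib_left mult.left_commute)
  next
    case False
    then have "indicat_real {\<rho> i * g<..g} x = 0" if "i \<in> I" for i
      using \<rho>g(1)[OF that] by (auto simp: indicator_def)
    then show ?thesis
      using False by simp
  qed
  have \<gamma>_int: "set_integrable lborel {0<..g} (\<lambda>x. x powr (s - d - 1) * \<gamma> x)"
    using source_integrable by (rule set_integrable_subset) auto
  have k_int': "set_integrable lborel {\<rho> i * g<..g} (k i)" if "i \<in> I" for i
    using k_int[OF \<rho>g(1)[OF that] that] by (rule set_integrable_subset) auto
  show ?int
    unfolding set_integrable_def h using \<gamma>_int k_int'
    by (intro Bochner_Integration.integrable_add Bochner_Integration.integrable_sum) (auto simp: set_integrable_def)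
  have "(LBINT x:{0<..g}. x powr (s - d - 1) * h x)
      = (LBINT x:{0<..g}. x powr (s - d - 1) * \<gamma> x) + (\<Sum>i\<in>I. LBINT x:{\<rho> i * g<..g}. k i x)"
    unfolding set_lebesgue_integral_def h using \<gamma>_int k_int'
    by (subst Bochner_Integration.integral_add Bochner_Integration.integral_sum;
        (intro Bochner_Integration.integrable_sum)?; simp add: set_integrable_def)+
  also have "(\<Sum>i\<in>I. LBINT x:{\<rho> i * g<..g}. k i x) = window g"
    by (simp add: k_integral window_def)
  also have "window g = (LBINT x:{g<..}. x powr (s - d - 1) * \<gamma> x)"
    using source_tail_eq_window[OF g] by simp
  also have "(LBINT x:{0<..g}. x powr (s - d - 1) * \<gamma> x) + \<dots> = (LBINT x:{0<..g} \<union> {g<..}. x powr (s - d - 1) * \<gamma> x)"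
    by (intro set_integral_Un[symmetric] \<gamma>_int \<gamma>_tail_integrable g) auto
  also have "{0<..g} \<union> {g<..} = {0<..}"
    using g by auto
  finally show ?eq
    by (simp add: source_def)
qed

end

section \<open>Parallel sets and frontiers\<close>

text \<open>The segment from \<open>x\<close> to a point of \<open>A\<close> outside \<open>X\<close> crosses the frontier of \<open>X\<close>, so a
point of \<open>B\<close> is at least as near.\<close>

lemma infdist_eq_of_frontier_subset:
  fixes X :: "'a::euclidean_space set"
  assumes x: "x \<in> X" and B: "frontier X \<subseteq> B" "B \<subseteq> A" "A \<inter> X \<subseteq> B" "B \<noteq> {}"
  shows "infdist x A = infdist x B"
proof (rule antisym)
  show "infdist x A \<le> infdist x B"
    using B(2,4) by (rule infdist_mono)
  have "infdist x B \<le> dist x a" if a: "a \<in> A" for a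
  proof (cases "a \<in> X")
    case True
    then show ?thesis
      using a B(3) by (intro infdist_le) auto
  next
    case False
    then have "closed_segment x a \<inter> frontier X \<noteq> {}"
      using x by (intro connected_Int_frontier) auto
    then obtain z where z: "z \<in> closed_segment x a" "z \<in> frontier X"
      by auto
    then have "dist x z \<le> dist x a"
      using dist_in_closed_segment[OF z(1)] by (simp add: dist_commute)
    then show ?thesis
      using z(2) B(1) by (intro infdist_le2[of z]) auto
  qed
  moreover have "A \<noteq> {}"
    using B by auto
  ultimately show "infdist x B \<le> infdist x A"
    unfolding infdist_notempty[OF \<open>A \<noteq> {}\<close>] by (intro cINF_greatest)
qed

lemma frontier_nonempty_of_bounded:
  fixes X :: "'a::euclidean_space set"
  assumes "X \<noteq> {}" "bounded X"
  shows "frontier X \<noteq> {}"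
  using assms frontier_eq_empty[of X] not_bounded_UNIV by auto

lemma closed_parallel_set: "closed (parallel_set A e)"
proof (cases "A = {}")
  case False
  then have "parallel_set A e = (\<lambda>z. infdist z A) -` {..e}"
    by (auto simp: parallel_set_def)
  then show ?thesis
    by (simp add: closed_vimage continuous_intros)
qed (simp add: parallel_set_def)

lemma bounded_parallel_set:
  assumes "bounded A"
  shows "bounded (parallel_set A e)"
proof -
  obtain a c where A: "A \<subseteq> cball a c"
    using assms by (auto simp: bounded_subset_cball)
  have "dist a z \<le> c + (\<bar>e\<bar> + 1)" if "z \<in> parallel_set A e" for z
  proof -
    have "infdist z A < \<bar>e\<bar> + 1" "A \<noteq> {}"
      using that by (auto simp: parallel_set_def)
    then obtain y where "y \<in> A" "dist z y < \<bar>e\<bar> + 1"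
      unfolding infdist_notempty[OF \<open>A \<noteq> {}\<close>] by (subst (asm) cINF_less_iff) (auto intro: bdd_belowI[of _ 0])
    moreover have "dist a y \<le> c"
      using A \<open>y \<in> A\<close> by auto
    ultimately show ?thesis
      using dist_triangle[of a z y] by (simp add: dist_commute)
  qed
  then have "parallel_set A e \<subseteq> cball a (c + (\<bar>e\<bar> + 1))"
    by auto
  then show ?thesis
    by (rule bounded_subset[OF bounded_cball])
qed

lemma parallel_set_mono: "e \<le> e' \<Longrightarrow> parallel_set A e \<subseteq> parallel_set A e'"
  by (auto simp: parallel_set_def)

lemma parallel_set_closed_iff:
  assumes "closed A" "A \<noteq> {}"
  shows "z \<in> parallel_set A e \<longleftrightarrow> (\<exists>a\<in>A. dist z a \<le> e)"
proof -
  obtain a where "a \<in> A" "infdist z A = dist z a"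
    using infdist_attains_inf[OF assms] by blast
  then show ?thesis
    using infdist_le2[of _ A z e] assms(2) by (auto simp: parallel_set_def)
qed

lemma closed_in_sets_lebesgue: "closed A \<Longrightarrow> A \<in> sets lebesgue"
  by (intro sets_completionI_sets) simp

lemma open_in_sets_lebesgue: "open A \<Longrightarrow> A \<in> sets lebesgue"
  by (intro sets_completionI_sets) simp

section \<open>The attractor and the tiling\<close>

text \<open>The dimension of \<open>F\<close> enters the geometry only through \<open>F\<close> being a Lebesgue null set.\<close>

locale compatible_ifs =
  fixes N :: nat and S :: "nat \<Rightarrow> 'a::euclidean_space \<Rightarrow> 'a" and r :: "nat \<Rightarrow> real" and F U :: "'a set"
  assumes ifs: "similarity_ifs N S r"
    and F: "self_similar_set N S F"
    and feasible: "feasible_open_set N S U"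
    and hits: "U \<inter> F \<noteq> {}"
    and compatible: "frontier U \<subseteq> F"
    and null: "measure lebesgue F = 0"
begin

abbreviation "G \<equiv> generator N S U"
abbreviation "T \<equiv> tiling_union N S U"

lemma ratio: "i \<in> {1..N} \<Longrightarrow> 0 < r i \<and> r i < 1"
  using ifs by (auto simp: similarity_ifs_def)

lemma max_ratio:
  obtains \<mu> where "0 < \<mu>" "\<mu> < 1" "\<And>i. i \<in> {1..N} \<Longrightarrow> r i \<le> \<mu>"
proof
  have "{1..N} \<noteq> {}"
    using ifs by (simp add: similarity_ifs_def)
  then show "0 < Max (r ` {1..N})" "Max (r ` {1..N}) < 1"
    using ratio by (auto simp: Max_gr_iff)
  show "r i \<le> Max (r ` {1..N})" if "i \<in> {1..N}" for i
    using that by (intro Max_ge) auto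
qed

lemma sim: "i \<in> {1..N} \<Longrightarrow> similarity (S i) (r i)"
  using ifs by (auto simp: similarity_ifs_def similarity_def)

lemma F_compact: "compact F" and F_nonempty: "F \<noteq> {}" and F_eq: "F = (\<Union>i\<in>{1..N}. S i ` F)"
  using F by (auto simp: self_similar_set_def ifs_op_def)

lemma F_closed: "closed F"
  using F_compact by (rule compact_imp_closed)

lemma F_map: "i \<in> {1..N} \<Longrightarrow> x \<in> F \<Longrightarrow> S i x \<in> F"
  using F_eq by blast

lemma F_null: "F \<in> null_sets lebesgue"
  using null lmeasurable_compact[OF F_compact] negligible_iff_measure0 negligible_iff_null_sets by blast

lemma U_open: "open U" and U_bounded: "bounded U" and U_nonempty: "U \<noteq> {}"
  using feasible by (auto simp: feasible_open_set_def)

lemma U_map: "i \<in> {1..N} \<Longrightarrow> x \<in> U \<Longrightarrow> S i x \<in> U"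
  and U_disjoint: "i \<in> {1..N} \<Longrightarrow> j \<in> {1..N} \<Longrightarrow> i \<noteq> j \<Longrightarrow> S i ` U \<inter> S j ` U = {}"
  using feasible unfolding feasible_open_set_def by blast+

lemma closure_U_map:
  assumes "i \<in> {1..N}" "x \<in> closure U"
  shows "S i x \<in> closure U"
proof -
  have "S i ` closure U \<subseteq> closure U"
    unfolding similarity.closure_image[OF sim[OF assms(1)], symmetric]
    using U_map[OF assms(1)] by (intro closure_mono) auto
  then show ?thesis
    using assms(2) by auto
qed

text \<open>The point of \<open>F\<close> farthest from \<open>closure U\<close> is the image of a point of \<open>F\<close> under
a contraction that preserves \<open>closure U\<close>; hence its distance is zero.\<close>

lemma F_subset_closure_U: "F \<subseteq> closure U"
proof -
  have "continuous_on F (\<lambda>x. infdist x (closure U))"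
    by (intro continuous_intros)
  then obtain x where x: "x \<in> F" "\<And>y. y \<in> F \<Longrightarrow> infdist y (closure U) \<le> infdist x (closure U)"
    using continuous_attains_sup[OF F_compact F_nonempty] by blast
  have "x \<in> (\<Union>i\<in>{1..N}. S i ` F)"
    unfolding F_eq[symmetric] by (rule x(1))
  then obtain i y where i: "i \<in> {1..N}" and y: "y \<in> F" "x = S i y"
    by blast
  have "infdist x (closure U) \<le> infdist x (S i ` closure U)"
    using closure_U_map[OF i] U_nonempty by (intro infdist_mono) auto
  also have "\<dots> = r i * infdist y (closure U)"
    using similarity.infdist_image[OF sim[OF i], of "closure U" y] U_nonempty y(2) by simp
  also have "\<dots> \<le> r i * infdist x (closure U)"
    using ratio[OF i] x(2)[OF y(1)] by (intro mult_left_mono) auto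
  finally have "(1 - r i) * infdist x (closure U) \<le> 0"
    by (simp add: algebra_simps)
  then have "infdist x (closure U) \<le> 0"
    using ratio[OF i] by (simp add: mult_le_0_iff)
  then have "infdist y (closure U) = 0" if "y \<in> F" for y
    using x(2)[OF that] infdist_nonneg[of y "closure U"] by simp
  then show ?thesis
    using U_nonempty in_closed_iff_infdist_zero[of "closure U"] by auto
qed

text \<open>Within \<open>S i ` U\<close> only the piece \<open>S i ` F\<close> of \<open>F\<close> is visible: the other pieces lie in the
closures of sets disjoint from this open set.\<close>

lemma preimage_in_F:
  assumes "i \<in> {1..N}" "x \<in> U" "S i x \<in> F"
  shows "x \<in> F"
proof -
  obtain j y where j: "j \<in> {1..N}" and y: "y \<in> F" "S i x = S j y"
  proof -
    have "S i x \<in> (\<Union>j\<in>{1..N}. S j ` F)"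
      unfolding F_eq[symmetric] by (rule assms(3))
    then show thesis
      using that by blast
  qed
  have "i = j"
  proof (rule ccontr)
    assume "i \<noteq> j"
    have "open (S i ` U)"
      by (rule similarity.open_image[OF sim[OF assms(1)] U_open])
    then have "S i ` U \<inter> closure (S j ` U) = {}"
      using U_disjoint[OF assms(1) j \<open>i \<noteq> j\<close>] by (simp add: open_Int_closure_eq_empty)
    moreover have "S j y \<in> closure (S j ` U)"
      using F_subset_closure_U y(1) by (auto simp: similarity.closure_image[OF sim[OF j]])
    ultimately show False
      using y(2) assms(2) by auto
  qed
  then show ?thesis
    using similarity.inj_map[OF sim[OF j]] y by (auto dest: injD)
qed

lemma closed_image_closure: "closed (\<Union>i\<in>{1..N}. S i ` closure U)"
  by (intro closed_UN) (auto simp: similarity.closure_image[OF sim, symmetric])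

lemma G_eq: "G = U - (\<Union>i\<in>{1..N}. S i ` closure U)"
  by (simp add: generator_def ifs_op_def)

lemma G_open: "open G"
  unfolding G_eq by (intro open_Diff U_open closed_image_closure)

lemma G_subset_U: "G \<subseteq> U"
  by (auto simp: G_eq)

lemma G_disjoint_F: "G \<inter> F = {}"
proof -
  have "F \<subseteq> (\<Union>i\<in>{1..N}. S i ` closure U)"
    using F_subset_closure_U by (subst F_eq) blast
  then show ?thesis
    by (auto simp: G_eq)
qed

lemma image_boundary_in_F:
  assumes "i \<in> {1..N}" "x \<in> closure U" "x \<notin> U"
  shows "S i x \<in> F"
  using assms compatible F_map U_open by (auto simp: frontier_def interior_open)

lemma frontier_G: "frontier G \<subseteq> F"
proof
  fix x assume "x \<in> frontier G"
  then have x: "x \<in> closure G" "x \<notin> G"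
    using G_open by (auto simp: frontier_def interior_open)
  show "x \<in> F"
  proof (cases "x \<in> U")
    case False
    then show ?thesis
      using x(1) closure_mono[OF G_subset_U] compatible U_open by (auto simp: frontier_def interior_open)
  next
    case True
    then obtain i y where i: "i \<in> {1..N}" and y: "y \<in> closure U" "x = S i y"
      using x(2) by (auto simp: G_eq)
    have "open (S i ` U)"
      by (rule similarity.open_image[OF sim[OF i] U_open])
    moreover have "S i ` U \<inter> G = {}"
      using i closure_subset[of U] unfolding G_eq by blast
    ultimately have "S i ` U \<inter> closure G = {}"
      by (simp add: open_Int_closure_eq_empty)
    then have "y \<notin> U"
      using y x(1) by auto
    then show ?thesis
      using image_boundary_in_F[OF i y(1)] y(2) by simp
  qed
qed

lemma T_eq_words: "T = (\<Union>w\<in>lists {1..N}. word_map S w ` G)"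
  by (auto simp: tiling_union_def tiling_def)

lemma G_subset_T: "G \<subseteq> T"
  unfolding T_eq_words by (rule subsetI, rule UN_I[of "[]"]) auto

lemma T_map: "i \<in> {1..N} \<Longrightarrow> x \<in> T \<Longrightarrow> S i x \<in> T"
  unfolding T_eq_words
proof (elim UN_E imageE)
  fix w y assume "i \<in> {1..N}" "w \<in> lists {1..N}" "y \<in> G" "x = word_map S w y"
  then show "S i x \<in> (\<Union>w\<in>lists {1..N}. word_map S w ` G)"
    by (intro UN_I[of "i # w"]) auto
qed

lemma tile_subset: "w \<in> lists {1..N} \<Longrightarrow> x \<in> G \<Longrightarrow> word_map S w x \<in> U - F"
proof (induction w)
  case Nil
  then show ?case
    using G_subset_U G_disjoint_F by auto
next
  case (Cons i w)
  then show ?case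
    using U_map preimage_in_F by auto
qed

text \<open>A point of \<open>closure U\<close> outside \<open>F\<close> lies in the generator or in one of the first-level copies
of \<open>closure U\<close>.  In the latter case its preimage is farther from \<open>F\<close> by at least the factor
\<open>1 / \<mu>\<close>; since distances on \<open>closure U\<close> are bounded, the generator is reached after
finitely many steps.\<close>

lemma T_eq: "T = U - F"
proof
  show "T \<subseteq> U - F"
    using tile_subset by (auto simp: T_eq_words)
  show "U - F \<subseteq> T"
  proof
    fix x assume x: "x \<in> U - F"
    have "compact (closure U)"
      using U_bounded by (simp add: compact_closure)
    moreover have "continuous_on (closure U) (\<lambda>x. infdist x F)"
      by (intro continuous_intros)
    ultimately obtain z where z: "\<And>y. y \<in> closure U \<Longrightarrow> infdist y F \<le> infdist z F"
      using continuous_attains_sup[of "closure U"] U_nonempty by (metis closure_eq_empty)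
    define c where "c = infdist z F"
    have "c \<ge> 0"
      by (simp add: c_def infdist_nonneg)
    obtain \<mu> where \<mu>: "0 < \<mu>" "\<mu> < 1" "\<And>i. i \<in> {1..N} \<Longrightarrow> r i \<le> \<mu>"
      by (rule max_ratio) blast
    have claim: "y \<in> T" if "y \<in> closure U" "y \<notin> F" "c * \<mu> ^ n < infdist y F" for n y
      using that
    proof (induction n arbitrary: y)
      case 0
      then show ?case
        using z[of y] by (simp add: c_def)
    next
      case (Suc n)
      have "y \<in> U"
        using Suc.prems compatible U_open by (auto simp: frontier_def interior_open)
      show ?case
      proof (cases "y \<in> G")
        case True
        then show ?thesis
          using G_subset_T by auto
      next
        case False
        then obtain i y' where i: "i \<in> {1..N}" and y': "y' \<in> closure U" "y = S i y'"
          using \<open>y \<in> U\<close> by (auto simp: G_eq)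
        have "c * \<mu> ^ n * \<mu> < infdist y F"
          using Suc.prems(3) by (simp add: mult_ac)
        also have "\<dots> \<le> infdist y (S i ` F)"
          using F_map[OF i] F_nonempty by (intro infdist_mono) auto
        also have "\<dots> = r i * infdist y' F"
          using similarity.infdist_image[OF sim[OF i] F_nonempty] y'(2) by simp
        also have "\<dots> \<le> \<mu> * infdist y' F"
          using \<mu>(3)[OF i] by (intro mult_right_mono infdist_nonneg)
        finally have "c * \<mu> ^ n < infdist y' F"
          using \<mu>(1) by (simp add: mult.commute)
        moreover have "y' \<notin> F"
          using Suc.prems(2) F_map[OF i] y'(2) by auto
        ultimately show ?thesis
          using Suc.IH[OF y'(1)] T_map[OF i] y'(2) by simp
      qed
    qed
    have "0 < infdist x F"
      using x F_closed F_nonempty by (simp add: infdist_pos_not_in_closed)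
    moreover have "(\<lambda>n. c * \<mu> ^ n) \<longlonglongrightarrow> c * 0"
      using \<mu> by (intro tendsto_mult tendsto_const LIMSEQ_power_zero) auto
    ultimately have "\<forall>\<^sub>F n in sequentially. c * \<mu> ^ n < infdist x F"
      by (intro order_tendstoD) simp_all
    then obtain n where "c * \<mu> ^ n < infdist x F"
      by (auto simp: eventually_sequentially)
    then show "x \<in> T"
      using claim[of x n] x closure_subset by auto
  qed
qed

lemma T_open: "open T"
  unfolding T_eq by (intro open_Diff U_open F_closed)

lemma frontier_T: "frontier T \<subseteq> F"
proof
  fix x assume "x \<in> frontier T"
  then have x: "x \<in> closure T" "x \<notin> T"
    using T_open by (auto simp: frontier_def interior_open)
  then have "x \<in> closure U"
    using closure_mono[of T U] by (auto simp: T_eq)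
  then show "x \<in> F"
    using x(2) compatible U_open by (auto simp: T_eq frontier_def interior_open)
qed

lemma sets_lebesgue [simp]:
  "U \<in> sets lebesgue" "G \<in> sets lebesgue" "T \<in> sets lebesgue" "F \<in> sets lebesgue"
  "parallel_set A e \<in> sets lebesgue"
  using U_open G_open T_open F_closed closed_parallel_set closed_in_sets_lebesgue open_in_sets_lebesgue by auto

lemma measure_Diff_F: "A \<in> sets lebesgue \<Longrightarrow> measure lebesgue (A - F) = measure lebesgue A"
  by (rule measure_Diff_null_set[OF _ F_null])

lemma measure_U_pos: "0 < measure lebesgue U"
proof -
  obtain a e where "0 < e" "ball a e \<subseteq> U"
    using U_open U_nonempty by (metis all_not_in_conv open_contains_ball)
  then have "0 < measure lebesgue (ball a e)"
    by (simp add: content_ball_gt_0_iff)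
  also have "\<dots> \<le> measure lebesgue U"
    using \<open>ball a e \<subseteq> U\<close> U_open U_bounded by (intro measure_mono_fmeasurable) (auto simp: lmeasurable_open)
  finally show ?thesis .
qed

lemma T_nonempty: "T \<noteq> {}"
proof
  assume "T = {}"
  then have "U - F = {}"
    unfolding T_eq .
  then have "measure lebesgue U = 0"
    using measure_Diff_F[of U] \<open>U - F = {}\<close> by (metis measure_empty sets_lebesgue(1))
  then show False
    using measure_U_pos by simp
qed

lemma G_nonempty: "G \<noteq> {}"
  using T_nonempty by (auto simp: T_eq_words)

lemma G_bounded: "bounded G" and T_bounded: "bounded T"
  using U_bounded G_subset_U by (auto simp: T_eq intro: bounded_subset)

section \<open>Collars of the attractor\<close>

text \<open>The parallel volume of \<open>F\<close> inside and outside \<open>U\<close>.  The inner part is the tube of the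
tiling, the outer part the tube that has to be shown negligible.\<close>

definition collar :: "real \<Rightarrow> real"
  where "collar e = measure lebesgue (parallel_set F e \<inter> U)"

definition outer_collar :: "real \<Rightarrow> real"
  where "outer_collar e = measure lebesgue (parallel_set F e - U)"

lemma infdist_frontier_T: "x \<in> T \<Longrightarrow> infdist x (frontier T) = infdist x F"
  using frontier_T T_nonempty T_bounded
  by (intro infdist_eq_of_frontier_subset[of x T, symmetric] frontier_nonempty_of_bounded) (auto simp: T_eq)

lemma infdist_frontier_G: "x \<in> G \<Longrightarrow> infdist x (frontier G) = infdist x F"
  using frontier_G G_disjoint_F G_nonempty G_bounded
  by (intro infdist_eq_of_frontier_subset[of x G, symmetric] frontier_nonempty_of_bounded) auto

lemma parallel_F_lmeasurable [simp]: "parallel_set F e \<in> lmeasurable"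
  using bounded_parallel_set[OF compact_imp_bounded[OF F_compact]]
  by (intro bounded_set_imp_lmeasurable) auto

lemma collar_lmeasurable [simp]: "parallel_set F e \<inter> A \<in> lmeasurable" "parallel_set F e - A \<in> lmeasurable"
  if "A \<in> sets lebesgue"
  using that fmeasurable_Int_fmeasurable[OF parallel_F_lmeasurable that, of e]
    fmeasurable_Diff[OF parallel_F_lmeasurable that, of e] by auto

lemma parallel_T: "parallel_set (frontier T) e \<inter> T = parallel_set F e \<inter> U - F"
  using frontier_nonempty_of_bounded[OF T_nonempty T_bounded] F_nonempty infdist_frontier_T
  by (auto simp: parallel_set_def T_eq)

lemma measure_parallel_T: "measure lebesgue (parallel_set (frontier T) e \<inter> T) = collar e"
  unfolding parallel_T collar_def using U_open by (intro measure_Diff_F) auto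

lemma inner_volume_T: "inner_volume T e = collar e"
proof -
  have "{x \<in> T. infdist x (frontier T) \<le> e} = parallel_set (frontier T) e \<inter> T"
    using frontier_nonempty_of_bounded[OF T_nonempty T_bounded] by (auto simp: parallel_set_def)
  then show ?thesis
    by (simp add: inner_volume_def measure_parallel_T)
qed

lemma inner_volume_G: "inner_volume G e = measure lebesgue (parallel_set F e \<inter> G)"
proof -
  have "{x \<in> G. infdist x (frontier G) \<le> e} = parallel_set F e \<inter> G"
    using infdist_frontier_G F_nonempty by (auto simp: parallel_set_def)
  then show ?thesis
    by (simp add: inner_volume_def)
qed

lemma image_borel_measure:
  "i \<in> {1..N} \<Longrightarrow> A \<in> sets borel \<Longrightarrow> measure lebesgue (S i ` A) = r i powr DIM('a) * measure lebesgue A"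
  by (rule similarity.measure_image_borel[OF sim])

lemma parallel_Int_open_borel: "open A \<Longrightarrow> parallel_set F e \<inter> A \<in> sets borel"
  using closed_parallel_set[of F e] by (intro sets.Int) auto

lemma inner_volume_image_T:
  assumes i: "i \<in> {1..N}"
  shows "inner_volume (S i ` T) e = r i powr DIM('a) * collar (e / r i)"
proof -
  have "{x \<in> S i ` T. infdist x (frontier (S i ` T)) \<le> e} = S i ` {x \<in> T. infdist x (frontier T) \<le> e / r i}"
    using similarity.infdist_image[OF sim[OF i] frontier_nonempty_of_bounded[OF T_nonempty T_bounded]] ratio[OF i]
    by (auto simp: similarity.frontier_image[OF sim[OF i]] field_simps)
  also have "{x \<in> T. infdist x (frontier T) \<le> e / r i} = parallel_set F (e / r i) \<inter> T"
    using infdist_frontier_T F_nonempty by (auto simp: parallel_set_def)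
  finally have "inner_volume (S i ` T) e = r i powr DIM('a) * measure lebesgue (parallel_set F (e / r i) \<inter> T)"
    using image_borel_measure[OF i parallel_Int_open_borel[OF T_open]] by (simp add: inner_volume_def)
  also have "parallel_set F (e / r i) \<inter> T = parallel_set F (e / r i) \<inter> U - F"
    by (auto simp: T_eq)
  also have "measure lebesgue \<dots> = collar (e / r i)"
    unfolding collar_def using U_open by (intro measure_Diff_F) auto
  finally show ?thesis .
qed

text \<open>Compatibility enters here: the frontier of \<open>S i ` U\<close> belongs to \<open>S i ` F\<close>, so inside
\<open>S i ` U\<close> the nearest point of \<open>F\<close> may be taken in \<open>S i ` F\<close>.\<close>

lemma infdist_image_F:
  assumes i: "i \<in> {1..N}" and x: "x \<in> U"
  shows "infdist (S i x) F = r i * infdist x F"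
proof -
  have "infdist (S i x) F = infdist (S i x) (S i ` F)"
  proof (rule infdist_eq_of_frontier_subset)
    show "S i x \<in> S i ` U"
      using x by simp
    show "frontier (S i ` U) \<subseteq> S i ` F"
      using compatible by (auto simp: similarity.frontier_image[OF sim[OF i]])
    show "S i ` F \<subseteq> F"
      using F_map[OF i] by auto
    show "F \<inter> S i ` U \<subseteq> S i ` F"
      using preimage_in_F[OF i] by auto
  qed (use F_nonempty in auto)
  then show ?thesis
    using similarity.infdist_image[OF sim[OF i] F_nonempty] by simp
qed

lemma parallel_Int_image_U:
  assumes i: "i \<in> {1..N}"
  shows "parallel_set F e \<inter> S i ` U = S i ` (parallel_set F (e / r i) \<inter> U)"
  using infdist_image_F[OF i] ratio[OF i] F_nonempty
  by (auto simp: parallel_set_def field_simps)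

text \<open>Up to null sets \<open>U\<close> is the disjoint union of the generator and the copies \<open>S i ` U\<close>, and the
collar of a copy is the copy of a collar.\<close>

lemma collar_renewal:
  "collar e = (\<Sum>i=1..N. r i powr DIM('a) * collar (e / r i)) + inner_volume G e"
proof -
  define P where "P = parallel_set F e"
  have P: "P \<inter> A \<in> lmeasurable" if "A \<in> sets lebesgue" for A
    using that by (simp add: P_def)
  have SU: "S i ` U \<in> sets lebesgue" if "i \<in> {1..N}" for i
    using similarity.open_image[OF sim[OF that] U_open] by auto
  have G: "G \<in> sets lebesgue"
    using G_open by auto
  have eq: "P \<inter> U - F = (P \<inter> G) \<union> (\<Union>i\<in>{1..N}. P \<inter> S i ` U - F)"
  proof (intro equalityI subsetI)
    fix x assume x: "x \<in> P \<inter> U - F"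
    show "x \<in> (P \<inter> G) \<union> (\<Union>i\<in>{1..N}. P \<inter> S i ` U - F)"
    proof (cases "x \<in> G")
      case False
      then obtain i y where i: "i \<in> {1..N}" and y: "y \<in> closure U" "x = S i y"
        using x unfolding G_eq by blast
      then have "y \<in> U"
        using image_boundary_in_F[OF i y(1)] x by blast
      then show ?thesis
        using i y x by blast
    qed (use x in blast)
  next
    fix x assume "x \<in> (P \<inter> G) \<union> (\<Union>i\<in>{1..N}. P \<inter> S i ` U - F)"
    then show "x \<in> P \<inter> U - F"
      using U_map G_disjoint_F G_subset_U by blast
  qed
  have disj: "(P \<inter> G) \<inter> (\<Union>i\<in>{1..N}. P \<inter> S i ` U - F) = {}"
    using closure_subset[of U] unfolding G_eq by blast
  have fm: "P \<inter> S i ` U - F \<in> lmeasurable" if "i \<in> {1..N}" for i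
    using P[OF SU[OF that]] by (intro fmeasurable_Diff) auto
  have "measure lebesgue (P \<inter> U - F)
      = measure lebesgue (P \<inter> G) + measure lebesgue (\<Union>i\<in>{1..N}. P \<inter> S i ` U - F)"
    unfolding eq by (subst measure_Un3) (use P[OF G] fm disj in \<open>auto intro: fmeasurable.finite_UN simp del: UN_simps\<close>)
  also have "measure lebesgue (\<Union>i\<in>{1..N}. P \<inter> S i ` U - F) = (\<Sum>i=1..N. measure lebesgue (P \<inter> S i ` U - F))"
  proof (rule measure_finite_Union)
    show "disjoint_family_on (\<lambda>i. P \<inter> S i ` U - F) {1..N}"
      using U_disjoint by (fastforce simp: disjoint_family_on_def)
    show "emeasure lebesgue (P \<inter> S i ` U - F) \<noteq> \<infinity>" if "i \<in> {1..N}" for i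
      using fmeasurableD2[OF fm[OF that]] by simp
    show "(\<lambda>i. P \<inter> S i ` U - F) ` {1..N} \<subseteq> sets lebesgue"
      using fm by (blast dest: fmeasurableD)
  qed simp
  also have "\<dots> = (\<Sum>i=1..N. measure lebesgue (P \<inter> S i ` U))"
    using P[OF SU] by (intro sum.cong refl measure_Diff_F) (auto simp: fmeasurable_def)
  also have "\<dots> = (\<Sum>i=1..N. r i powr DIM('a) * collar (e / r i))"
    using U_open
    by (intro sum.cong refl) (simp add: P_def parallel_Int_image_U collar_def image_borel_measure parallel_Int_open_borel)
  also have "measure lebesgue (P \<inter> U - F) = collar e"
    unfolding collar_def P_def using U_open by (intro measure_Diff_F) auto
  finally show ?thesis
    by (simp add: inner_volume_G P_def)
qed

lemma collar_mono: "mono collar"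
proof (rule monoI)
  show "collar e \<le> collar e'" if "e \<le> e'" for e e'
    unfolding collar_def using parallel_set_mono[OF that, of F]
    by (intro measure_mono_fmeasurable) auto
qed

lemma collar_nonneg: "0 \<le> collar e"
  by (simp add: collar_def)

lemma collar_le: "collar e \<le> measure lebesgue U"
  unfolding collar_def using U_open U_bounded by (intro measure_mono_fmeasurable) (auto simp: lmeasurable_open)

lemma inner_volume_G_mono: "mono (inner_volume G)"
proof (rule monoI)
  show "inner_volume G e \<le> inner_volume G e'" if "e \<le> e'" for e e'
    unfolding inner_volume_G using parallel_set_mono[OF that, of F]
    by (intro measure_mono_fmeasurable) auto
qed

lemma inner_volume_nonneg: "0 \<le> inner_volume A e"
  by (simp add: inner_volume_def)

lemma inner_volume_G_nonzero: "\<exists>e>0. 0 < inner_volume G e"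
proof -
  obtain x where x: "x \<in> G"
    using G_nonempty by auto
  then have "x \<notin> F"
    using G_disjoint_F by auto
  define e where "e = infdist x F + 1"
  have e: "0 < e"
    using infdist_nonneg[of x F] by (simp add: e_def)
  have "open ({y. infdist y F < e} \<inter> G)"
    by (intro open_Int G_open open_Collect_less continuous_intros)
  moreover have "x \<in> {y. infdist y F < e} \<inter> G"
    using x by (simp add: e_def)
  ultimately obtain t where t: "0 < t" "ball x t \<subseteq> {y. infdist y F < e} \<inter> G"
    by (meson open_contains_ball)
  have "0 < measure lebesgue (ball x t)"
    using t(1) by (simp add: content_ball_gt_0_iff)
  also have "\<dots> \<le> inner_volume G e"
    unfolding inner_volume_G
  proof (rule measure_mono_fmeasurable)
    show "ball x t \<subseteq> parallel_set F e \<inter> G"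
      using t(2) F_nonempty by (auto simp: parallel_set_def)
  qed auto
  finally show ?thesis
    using e by blast
qed

lemma inradius_G_pos: "0 < inradius G"
proof -
  have ne: "frontier G \<noteq> {}"
    by (rule frontier_nonempty_of_bounded[OF G_nonempty G_bounded])
  obtain x where x: "x \<in> G"
    using G_nonempty by auto
  then have "x \<notin> frontier G"
    using G_open by (simp add: frontier_def interior_open)
  then have "0 < infdist x (frontier G)"
    using ne by (intro infdist_pos_not_in_closed) auto
  also have "\<dots> \<le> inradius G"
    unfolding inradius_def
  proof (rule cSUP_upper[OF x])
    have "compact (closure G)"
      using G_bounded by (simp add: compact_closure)
    then have "bounded ((\<lambda>x. infdist x (frontier G)) ` closure G)"
      by (intro compact_imp_bounded compact_continuous_image continuous_intros)
    then have "bdd_above ((\<lambda>x. infdist x (frontier G)) ` closure G)"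
      by (rule bounded_imp_bdd_above)
    then show "bdd_above ((\<lambda>x. infdist x (frontier G)) ` G)"
      by (rule bdd_above_mono) (auto intro: closure_subset[THEN subsetD])
  qed
  finally show ?thesis .
qed

section \<open>Words and coverings\<close>

definition words :: "nat \<Rightarrow> nat list set"
  where "words n = {w. set w \<subseteq> {1..N} \<and> length w = n}"

definition word_ratio :: "nat list \<Rightarrow> real"
  where "word_ratio w = prod_list (map r w)"

lemma words_0: "words 0 = {[]}"
  by (auto simp: words_def)

lemma words_Suc: "words (Suc n) = (\<lambda>(i, w). i # w) ` ({1..N} \<times> words n)"
  by (auto simp: words_def length_Suc_conv image_iff)

lemma finite_words: "finite (words n)"
  by (induction n) (auto simp: words_0 words_Suc)

lemma word_ratio_pos: "w \<in> words n \<Longrightarrow> 0 < word_ratio w"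
  using ratio by (induction n arbitrary: w) (auto simp: words_0 words_Suc word_ratio_def)

lemma word_sim: "w \<in> words n \<Longrightarrow> similarity (word_map S w) (word_ratio w)"
proof (induction n arbitrary: w)
  case 0
  then show ?case
    by (auto simp: words_0 word_ratio_def similarity_def)
next
  case (Suc n)
  then obtain i v where w: "w = i # v" "i \<in> {1..N}" "v \<in> words n"
    by (auto simp: words_Suc)
  interpret i: similarity "S i" "r i"
    by (rule sim[OF w(2)])
  interpret v: similarity "word_map S v" "word_ratio v"
    by (rule Suc.IH[OF w(3)])
  show ?case
    using i.ratio_pos v.ratio_pos
    by (auto simp: similarity_def w(1) i.dist_map v.dist_map word_ratio_def)
qed

lemma word_map_U: "w \<in> words n \<Longrightarrow> x \<in> U \<Longrightarrow> word_map S w x \<in> U"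
proof (induction n arbitrary: w)
  case (Suc n)
  then obtain i v where "w = i # v" "i \<in> {1..N}" "v \<in> words n"
    by (auto simp: words_Suc)
  then show ?case
    using Suc U_map by simp
qed (simp add: words_0)

lemma F_words: "x \<in> F \<Longrightarrow> \<exists>w\<in>words n. \<exists>y\<in>F. x = word_map S w y"
proof (induction n arbitrary: x)
  case 0
  then show ?case
    by (auto simp: words_0)
next
  case (Suc n)
  have "x \<in> (\<Union>i\<in>{1..N}. S i ` F)"
    unfolding F_eq[symmetric] by (rule Suc.prems)
  then obtain i z where i: "i \<in> {1..N}" and z: "z \<in> F" "x = S i z"
    by blast
  obtain w y where "w \<in> words n" "y \<in> F" "z = word_map S w y"
    using Suc.IH[OF z(1)] by blast
  then show ?case
    using i z by (intro bexI[of _ "i # w"] bexI[of _ y]) (auto simp: words_Suc)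
qed

lemma sum_word_ratio_powr:
  fixes s :: real
  shows "(\<Sum>w\<in>words n. word_ratio w powr s) = (\<Sum>i=1..N. r i powr s) ^ n"
proof (induction n)
  case 0
  then show ?case
    by (simp add: words_0 word_ratio_def)
next
  case (Suc n)
  have "(\<Sum>w\<in>words (Suc n). word_ratio w powr s) = (\<Sum>(i, w)\<in>{1..N} \<times> words n. (r i * word_ratio w) powr s)"
    unfolding words_Suc by (subst sum.reindex) (auto simp: inj_on_def word_ratio_def intro!: sum.cong)
  also have "\<dots> = (\<Sum>(i, w)\<in>{1..N} \<times> words n. r i powr s * word_ratio w powr s)"
    using ratio word_ratio_pos by (intro sum.cong refl) (auto simp: powr_mult less_imp_le)
  also have "\<dots> = (\<Sum>i=1..N. r i powr s) * (\<Sum>w\<in>words n. word_ratio w powr s)"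
    by (simp add: sum_product sum.cartesian_product)
  finally show ?case
    using Suc.IH by simp
qed

lemma word_ratio_le:
  assumes "\<And>i. i \<in> {1..N} \<Longrightarrow> r i \<le> \<mu>" "0 < \<mu>"
  shows "w \<in> words n \<Longrightarrow> word_ratio w \<le> \<mu> ^ n"
proof (induction n arbitrary: w)
  case (Suc n)
  then obtain i v where w: "w = i # v" "i \<in> {1..N}" "v \<in> words n"
    by (auto simp: words_Suc)
  have "r i * word_ratio v \<le> \<mu> * \<mu> ^ n"
    using assms Suc.IH[OF w(3)] word_ratio_pos[OF w(3)] w(2) by (intro mult_mono) auto
  then show ?case
    by (simp add: w(1) word_ratio_def)
qed (auto simp: words_0 word_ratio_def)

lemma word_ratio_less_1: "w \<in> words (Suc n) \<Longrightarrow> word_ratio w < 1"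
proof -
  assume w: "w \<in> words (Suc n)"
  obtain \<mu> where \<mu>: "0 < \<mu>" "\<mu> < 1" "\<And>i. i \<in> {1..N} \<Longrightarrow> r i \<le> \<mu>"
    by (rule max_ratio) blast
  have "word_ratio w \<le> \<mu> ^ Suc n"
    using \<mu> w by (intro word_ratio_le)
  also have "\<dots> < 1"
    using \<mu> by (intro power_Suc_less_one)
  finally show ?thesis .
qed

lemma parallel_set_word_cover:
  assumes "x \<in> parallel_set F e"
  obtains w y where "w \<in> words n" "y \<in> parallel_set F (e / word_ratio w)" "x = word_map S w y"
    "infdist x (word_map S w ` F) \<le> e"
proof -
  obtain a where a: "a \<in> F" "dist x a \<le> e"
    using assms parallel_set_closed_iff[OF F_closed F_nonempty] by blast
  obtain w z where w: "w \<in> words n" and z: "z \<in> F" "a = word_map S w z"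
    using F_words[OF a(1)] by blast
  interpret w: similarity "word_map S w" "word_ratio w"
    by (rule word_sim[OF w])
  obtain y where y: "x = word_map S w y"
    using w.surj_map by (metis surjD)
  have "dist y z \<le> e / word_ratio w"
    using a(2) w.ratio_pos by (simp add: y z(2) w.dist_map field_simps)
  then have "y \<in> parallel_set F (e / word_ratio w)"
    using z(1) parallel_set_closed_iff[OF F_closed F_nonempty] by blast
  moreover have "infdist x (word_map S w ` F) \<le> e"
    using a z by (intro infdist_le2[of a]) auto
  ultimately show thesis
    using that w y by blast
qed

lemma volume_word_cover:
  assumes W: "W \<subseteq> words n" and A: "A \<in> sets borel"
    and cover: "parallel_set F e \<inter> A \<subseteq> (\<Union>w\<in>W. word_map S w ` (parallel_set F (e / word_ratio w) \<inter> A))"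
  shows "measure lebesgue (parallel_set F e \<inter> A)
    \<le> (\<Sum>w\<in>W. word_ratio w powr DIM('a) * measure lebesgue (parallel_set F (e / word_ratio w) \<inter> A))"
proof -
  define P where "P w = parallel_set F (e / word_ratio w) \<inter> A" for w
  have fin: "finite W"
    using W finite_words by (rule finite_subset)
  have P: "P w \<in> sets borel" "bounded (P w)" for w
    using A closed_parallel_set[of F "e / word_ratio w"] bounded_parallel_set[OF compact_imp_bounded[OF F_compact]]
    by (auto simp: P_def intro: sets.Int bounded_Int)
  have fm: "word_map S w ` P w \<in> lmeasurable" if "w \<in> W" for w
  proof (rule bounded_set_imp_lmeasurable)
    have w: "similarity (word_map S w) (word_ratio w)"
      using word_sim that W by blast
    show "word_map S w ` P w \<in> sets lebesgue"
      using similarity.borel_image[OF w P(1)] by (intro sets_completionI_sets) simp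
    obtain a c where "P w \<subseteq> cball a c"
      using P(2)[of w] by (auto simp: bounded_subset_cball)
    then have "word_map S w ` P w \<subseteq> cball (word_map S w a) (word_ratio w * c)"
      unfolding similarity.image_cball[OF w, symmetric] by blast
    then show "bounded (word_map S w ` P w)"
      by (rule bounded_subset[OF bounded_cball])
  qed
  have "measure lebesgue (parallel_set F e \<inter> A) \<le> measure lebesgue (\<Union>w\<in>W. word_map S w ` P w)"
  proof (rule measure_mono_fmeasurable)
    show "parallel_set F e \<inter> A \<subseteq> (\<Union>w\<in>W. word_map S w ` P w)"
      using cover by (simp add: P_def)
    show "parallel_set F e \<inter> A \<in> sets lebesgue"
      using A by (intro sets.Int sets_lebesgue) (auto intro: sets_completionI_sets)
    show "(\<Union>w\<in>W. word_map S w ` P w) \<in> lmeasurable"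
      using fin fm by (rule fmeasurable.finite_UN)
  qed
  also have "\<dots> \<le> (\<Sum>w\<in>W. measure lebesgue (word_map S w ` P w))"
    using fm fin by (intro measure_UNION_le) auto
  also have "\<dots> = (\<Sum>w\<in>W. word_ratio w powr DIM('a) * measure lebesgue (P w))"
    using W word_sim P(1) by (intro sum.cong refl similarity.measure_image_borel) blast+
  finally show ?thesis
    by (simp add: P_def)
qed

text \<open>Covering \<open>F\<close> by its first-level copies bounds its parallel volume by the scaled ones.\<close>

lemma volume_growth:
  fixes s :: real
  assumes moran: "(\<Sum>i=1..N. r i powr s) = 1" and s: "s \<le> DIM('a)"
  shows "\<exists>M\<ge>0. \<forall>e. 0 < e \<and> e \<le> 1 \<longrightarrow> measure lebesgue (parallel_set F e) \<le> M * e powr (DIM('a) - s)"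
proof (rule scaling_growth_bound[where I = "words 1" and \<rho> = word_ratio and q = "\<lambda>w. word_ratio w powr DIM('a)"
      and f = "\<lambda>e. measure lebesgue (parallel_set F e)" and t = "DIM('a) - s" and \<alpha> = 1])
  show "finite (words 1)"
    by (rule finite_words)
  show "0 < word_ratio w \<and> word_ratio w < 1" if "w \<in> words 1" for w
    using that word_ratio_pos word_ratio_less_1[of w 0] by auto
  show "(\<Sum>w\<in>words 1. word_ratio w powr real DIM('a) * word_ratio w powr - (real DIM('a) - s)) \<le> 1"
    using sum_word_ratio_powr[of s 1] moran by (simp flip: powr_add)
  show "mono (\<lambda>e. measure lebesgue (parallel_set F e))"
    using parallel_set_mono by (intro monoI measure_mono_fmeasurable) auto
  show "measure lebesgue (parallel_set F e)
     \<le> (\<Sum>w\<in>words 1. word_ratio w powr real DIM('a) * measure lebesgue (parallel_set F (e / word_ratio w)))" for e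
  proof -
    have "parallel_set F e \<inter> UNIV \<subseteq> (\<Union>w\<in>words 1. word_map S w ` (parallel_set F (e / word_ratio w) \<inter> UNIV))"
    proof
      fix x assume "x \<in> parallel_set F e \<inter> UNIV"
      then have "x \<in> parallel_set F e"
        by simp
      then show "x \<in> (\<Union>w\<in>words 1. word_map S w ` (parallel_set F (e / word_ratio w) \<inter> UNIV))"
        by (rule parallel_set_word_cover[where n = 1]) auto
    qed
    then show ?thesis
      using volume_word_cover[of "words 1" 1 UNIV e] by simp
  qed
qed (use s in auto)

text \<open>A point of \<open>F\<close> in \<open>U\<close> lies in copies of \<open>F\<close> of arbitrarily small diameter,
which a ball around the point inside \<open>U\<close> eventually contains.\<close>

lemma word_inside:
  obtains n \<tau> \<alpha> where "\<tau> \<in> words (Suc n)" "0 < \<alpha>"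
    "\<And>x. infdist x (word_map S \<tau> ` F) < \<alpha> \<Longrightarrow> x \<in> U"
proof -
  obtain p e where p: "p \<in> F" and e: "0 < e" "ball p e \<subseteq> U"
    using hits U_open by (metis disjoint_iff open_contains_ball)
  obtain c where c: "\<And>x y. x \<in> F \<Longrightarrow> y \<in> F \<Longrightarrow> dist x y \<le> c"
    using compact_imp_bounded[OF F_compact] by (auto simp: bounded_two_points)
  have "0 \<le> c"
    using c[OF p p] by simp
  obtain \<mu> where \<mu>: "0 < \<mu>" "\<mu> < 1" "\<And>i. i \<in> {1..N} \<Longrightarrow> r i \<le> \<mu>"
    by (rule max_ratio) blast
  have "(\<lambda>n. \<mu> ^ n * c) \<longlonglongrightarrow> 0 * c"
    using \<mu> by (intro tendsto_mult tendsto_const LIMSEQ_power_zero) auto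
  then have "(\<lambda>n. \<mu> ^ n * c) \<longlonglongrightarrow> 0"
    by simp
  then have "\<forall>\<^sub>F n in sequentially. \<mu> ^ n * c < e / 2"
    by (rule order_tendstoD) (use e in simp)
  then obtain n where n: "\<And>m. n \<le> m \<Longrightarrow> \<mu> ^ m * c < e / 2"
    by (auto simp: eventually_sequentially)
  have n: "\<mu> ^ Suc n * c < e / 2"
    by (rule n) simp
  obtain \<tau> z where \<tau>: "\<tau> \<in> words (Suc n)" and z: "z \<in> F" "p = word_map S \<tau> z"
    using F_words[OF p] by blast
  interpret \<tau>: similarity "word_map S \<tau>" "word_ratio \<tau>"
    by (rule word_sim[OF \<tau>])
  show thesis
  proof
    show "\<tau> \<in> words (Suc n)" "0 < e / 2"
      using \<tau> e by auto
    fix x assume x: "infdist x (word_map S \<tau> ` F) < e / 2"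
    have "closure (word_map S \<tau> ` F) = word_map S \<tau> ` F"
      by (simp add: \<tau>.closure_image F_closed closure_closed)
    then have "closed (word_map S \<tau> ` F)"
      by (simp only: closure_eq)
    moreover have "word_map S \<tau> ` F \<noteq> {}"
      using F_nonempty by blast
    ultimately obtain q where "q \<in> word_map S \<tau> ` F" "infdist x (word_map S \<tau> ` F) = dist x q"
      by (rule infdist_attains_inf)
    then obtain y where y: "y \<in> F" "dist x (word_map S \<tau> y) < e / 2"
      using x by auto
    have "dist (word_map S \<tau> y) p = word_ratio \<tau> * dist y z"
      unfolding z(2) by (rule \<tau>.dist_map)
    also have "\<dots> \<le> \<mu> ^ Suc n * c"
      using word_ratio_le[OF \<mu>(3,1) \<tau>] c[OF y(1) z(1)] \<open>0 \<le> c\<close> \<mu>(1) by (intro mult_mono) auto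
    finally have "dist x p < e"
      using n y(2) dist_triangle[of x p "word_map S \<tau> y"] by linarith
    then show "x \<in> U"
      using e(2) by (simp add: subset_iff dist_commute)
  qed
qed

lemma outer_collar_mono: "mono outer_collar"
proof (rule monoI)
  show "outer_collar e \<le> outer_collar e'" if "e \<le> e'" for e e'
    unfolding outer_collar_def using parallel_set_mono[OF that, of F]
    by (intro measure_mono_fmeasurable) auto
qed

lemma outer_collar_nonneg: "0 \<le> outer_collar e"
  by (simp add: outer_collar_def)

text \<open>Since \<open>U\<close> meets \<open>F\<close>, some copy of \<open>F\<close> lies in the interior of \<open>U\<close> and does not
contribute to the part of a thin parallel set outside \<open>U\<close>.  Dropping its word from the covering
makes the Moran sum strictly smaller than one, so a smaller exponent \<open>s'\<close> suffices.\<close>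

lemma outer_collar_growth:
  fixes s :: real
  assumes moran: "(\<Sum>i=1..N. r i powr s) = 1" and s: "s \<le> DIM('a)"
  shows "\<exists>s'<s. \<exists>M\<ge>0. \<exists>\<alpha>>0. \<forall>e. 0 < e \<and> e \<le> \<alpha> \<longrightarrow> outer_collar e \<le> M * e powr (real DIM('a) - s')"
proof -
  obtain n \<tau> \<alpha> where \<tau>: "\<tau> \<in> words (Suc n)" and \<alpha>: "0 < \<alpha>"
    "\<And>x. infdist x (word_map S \<tau> ` F) < \<alpha> \<Longrightarrow> x \<in> U"
    by (rule word_inside) blast
  define W where "W = words (Suc n) - {\<tau>}"
  have fin: "finite W"
    using finite_words by (simp add: W_def)
  have pos: "0 < word_ratio w" "word_ratio w < 1" if "w \<in> W" for w
    using that word_ratio_pos word_ratio_less_1 by (auto simp: W_def)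
  have "(\<Sum>w\<in>words (Suc n). word_ratio w powr s) = 1"
    using moran by (simp add: sum_word_ratio_powr)
  then have "(\<Sum>w\<in>W. word_ratio w powr s) < 1"
    using \<tau> word_ratio_pos[OF \<tau>] finite_words by (simp add: W_def sum_diff1)
  moreover have "((\<lambda>t. \<Sum>w\<in>W. word_ratio w powr t) \<longlongrightarrow> (\<Sum>w\<in>W. word_ratio w powr s)) (at_left s)"
  proof (intro tendsto_sum tendsto_powr tendsto_const tendsto_ident_at)
    show "word_ratio w \<noteq> 0" if "w \<in> W" for w
      using pos(1)[OF that] by simp
  qed
  ultimately have "\<forall>\<^sub>F t in at_left s. (\<Sum>w\<in>W. word_ratio w powr t) < 1"
    by (intro order_tendstoD)
  moreover have "\<forall>\<^sub>F t in at_left s. t < s"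
    by (simp add: eventually_at_filter)
  ultimately have "\<forall>\<^sub>F t in at_left s. t < s \<and> (\<Sum>w\<in>W. word_ratio w powr t) < 1"
    by eventually_elim auto
  then have "\<exists>t. t < s \<and> (\<Sum>w\<in>W. word_ratio w powr t) < 1"
    by (rule eventually_happens'[OF trivial_limit_at_left_real])
  then obtain s' where s': "s' < s" "(\<Sum>w\<in>W. word_ratio w powr s') < 1"
    by blast
  have "\<exists>M\<ge>0. \<forall>e. 0 < e \<and> e \<le> \<alpha> \<longrightarrow> outer_collar e \<le> M * e powr (DIM('a) - s')"
  proof (rule scaling_growth_bound[where I = W and \<rho> = word_ratio and q = "\<lambda>w. word_ratio w powr DIM('a)"
        and f = outer_collar and t = "DIM('a) - s'" and \<alpha> = \<alpha>])
    show "(\<Sum>w\<in>W. word_ratio w powr real DIM('a) * word_ratio w powr - (real DIM('a) - s')) \<le> 1"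
      using s'(2) by (simp flip: powr_add)
    show "mono outer_collar"
      by (rule outer_collar_mono)
    show "outer_collar e \<le> (\<Sum>w\<in>W. word_ratio w powr real DIM('a) * outer_collar (e / word_ratio w))"
      if e: "0 < e" "e < \<alpha>" for e
    proof -
      have "parallel_set F e \<inter> - U \<subseteq> (\<Union>w\<in>W. word_map S w ` (parallel_set F (e / word_ratio w) \<inter> - U))"
      proof
        fix x assume x: "x \<in> parallel_set F e \<inter> - U"
        then have "x \<in> parallel_set F e"
          by simp
        then obtain w y where w: "w \<in> words (Suc n)" and y: "y \<in> parallel_set F (e / word_ratio w)"
          "x = word_map S w y" "infdist x (word_map S w ` F) \<le> e"
          by (rule parallel_set_word_cover)
        have "w \<noteq> \<tau>"
        proof
          assume "w = \<tau>"
          then have "x \<in> U"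
            using y(3) e(2) by (intro \<alpha>(2)) simp
          then show False
            using x by simp
        qed
        moreover have "y \<notin> U"
          using word_map_U[OF w, of y] x unfolding y(2) by blast
        ultimately show "x \<in> (\<Union>w\<in>W. word_map S w ` (parallel_set F (e / word_ratio w) \<inter> - U))"
          unfolding y(2) using w y(1) by (auto simp: W_def)
      qed
      moreover have "W \<subseteq> words (Suc n)" "- U \<in> sets borel"
        using U_open by (auto simp: W_def)
      ultimately show ?thesis
        unfolding outer_collar_def Diff_eq by (intro volume_word_cover)
    qed
    show "0 \<le> real DIM('a) - s'"
      using s s'(1) by simp
    show "0 < word_ratio w \<and> word_ratio w < 1" if "w \<in> W" for w
      using pos[OF that] by simp
    show "0 \<le> outer_collar e" for e
      by (simp add: outer_collar_def)
  qed (use fin \<alpha>(1) in simp_all)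
  then show ?thesis
    using s'(1) \<alpha>(1) by blast
qed

end

section \<open>Growth exponents and contents\<close>

lemma eventually_unit_at_right_0: "\<forall>\<^sub>F e in at_right (0::real). 0 < e \<and> e < 1"
  using eventually_at_right_real[of 0 1] by (auto elim: eventually_mono)

lemma log_ratio_tendsto:
  fixes v :: "real \<Rightarrow> real"
  assumes c: "0 < c"
    and bounds: "\<forall>\<^sub>F e in at_right 0. c * e powr a \<le> v e \<and> v e \<le> C * e powr a"
  shows "((\<lambda>e. ln (v e) / ln e) \<longlongrightarrow> a) (at_right 0)"
proof (rule tendsto_sandwich)
  note small = eventually_unit_at_right_0
  have C: "\<forall>\<^sub>F e in at_right (0::real). 0 < C"
    using bounds small
  proof eventually_elim
    case (elim e)
    then have "0 < c * e powr a"
      using c by simp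
    with elim have "0 < C * e powr a"
      by linarith
    then show ?case
      by (simp add: zero_less_mult_iff)
  qed
  have *: "((\<lambda>e. a + k / ln e) \<longlongrightarrow> a) (at_right 0)" for k :: real
  proof -
    have "filterlim (\<lambda>e. ln e :: real) at_infinity (at_right 0)"
      by (rule filterlim_mono[OF ln_at_0 at_bot_le_at_infinity order_refl])
    then have "((\<lambda>e. k / ln e) \<longlongrightarrow> 0) (at_right 0)"
      by (rule tendsto_divide_0[OF tendsto_const])
    from tendsto_add[OF tendsto_const this] show ?thesis
      by simp
  qed
  show "((\<lambda>e. a + ln C / ln e) \<longlongrightarrow> a) (at_right 0)" "((\<lambda>e. a + ln c / ln e) \<longlongrightarrow> a) (at_right 0)"
    by (rule *)+
  show "\<forall>\<^sub>F e in at_right 0. a + ln C / ln e \<le> ln (v e) / ln e"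
    using bounds small C
  proof eventually_elim
    case (elim e)
    have "0 < c * e powr a"
      using elim c by simp
    then have "ln (v e) \<le> ln (C * e powr a)"
      using elim by (intro ln_mono) linarith+
    also have "\<dots> = ln C + a * ln e"
      using elim by (simp add: ln_mult ln_powr)
    finally have "(ln C + a * ln e) / ln e \<le> ln (v e) / ln e"
      using elim by (intro divide_right_mono_neg) auto
    then show ?case
      using elim by (simp add: add_divide_distrib)
  qed
  show "\<forall>\<^sub>F e in at_right 0. ln (v e) / ln e \<le> a + ln c / ln e"
    using bounds small
  proof eventually_elim
    case (elim e)
    have pos: "0 < c * e powr a"
      using elim c by simp
    have "ln c + a * ln e = ln (c * e powr a)"
      using elim c by (simp add: ln_mult ln_powr)
    also have "\<dots> \<le> ln (v e)"
      using elim pos by (intro ln_mono) linarith+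
    finally have "ln (v e) / ln e \<le> (ln c + a * ln e) / ln e"
      using elim by (intro divide_right_mono_neg) auto
    then show ?case
      using elim by (simp add: add_divide_distrib)
  qed
qed

lemma log_ratio_of_content:
  fixes v :: "real \<Rightarrow> real"
  assumes "((\<lambda>e. e powr - a * v e) \<longlongrightarrow> m) (at_right 0)" "0 < m"
  shows "((\<lambda>e. ln (v e) / ln e) \<longlongrightarrow> a) (at_right 0)"
proof (rule log_ratio_tendsto)
  have "\<forall>\<^sub>F e in at_right 0. m / 2 < e powr - a * v e" "\<forall>\<^sub>F e in at_right 0. e powr - a * v e < 2 * m"
    using order_tendstoD(1)[OF assms(1), of "m / 2"] order_tendstoD(2)[OF assms(1), of "2 * m"] assms(2) by auto
  moreover have "\<forall>\<^sub>F e in at_right (0::real). 0 < e"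
    by (rule eventually_at_right_less)
  ultimately show "\<forall>\<^sub>F e in at_right 0. m / 2 * e powr a \<le> v e \<and> v e \<le> 2 * m * e powr a"
    by eventually_elim (auto simp: powr_minus field_simps)
qed (use assms in simp)

lemma set_integrable_density_Icc:
  fixes f :: "real \<Rightarrow> real"
  assumes "mono f" "\<And>x. 0 \<le> f x" "0 < \<delta>" "a \<le> 0"
  shows "set_integrable lborel {\<delta>..1} (\<lambda>x. x powr a * f x / x)"
proof (rule set_integrable_bound)
  have "emeasure lborel {\<delta>..1} < \<infinity>"
    by (simp add: emeasure_lborel_Icc_eq)
  then show "set_integrable lborel {\<delta>..1} (\<lambda>x. \<delta> powr a * f 1 / \<delta>)"
    unfolding set_integrable_def by (intro integrable_scaleR_left integrable_real_indicator) auto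
  have [measurable]: "f \<in> borel_measurable borel"
    using assms(1) by (rule borel_measurable_mono)
  show "set_borel_measurable lborel {\<delta>..1} (\<lambda>x. x powr a * f x / x)"
    unfolding set_borel_measurable_def by measurable
  show "AE x in lborel. x \<in> {\<delta>..1} \<longrightarrow> norm (x powr a * f x / x) \<le> norm (\<delta> powr a * f 1 / \<delta>)"
  proof (intro AE_I2 impI)
    fix x assume x: "x \<in> {\<delta>..1}"
    have "x powr a * f x / x \<le> \<delta> powr a * f 1 / \<delta>"
      using x assms by (intro frac_le mult_mono powr_mono2' monoD[OF assms(1)]) auto
    then show "norm (x powr a * f x / x) \<le> norm (\<delta> powr a * f 1 / \<delta>)"
      using x assms by simp
  qed
qed

context compatible_ifs
begin

lemma volume_split: "measure lebesgue (parallel_set F e) = collar e + outer_collar e"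
proof -
  have "parallel_set F e = (parallel_set F e \<inter> U) \<union> (parallel_set F e - U)"
    by blast
  then have "measure lebesgue (parallel_set F e)
      = measure lebesgue ((parallel_set F e \<inter> U) \<union> (parallel_set F e - U))"
    by (rule arg_cong)
  also have "\<dots> = collar e + outer_collar e"
  proof -
    have disj: "(parallel_set F e \<inter> U) \<inter> (parallel_set F e - U) = {}"
      by blast
    show ?thesis
      unfolding collar_def outer_collar_def by (subst measure_Un3) (auto simp: disj)
  qed
  finally show ?thesis .
qed

text \<open>The outer part is smaller than the order of the contents by a power of \<open>e\<close>, which makes it
negligible both in the limit and, being integrable against \<open>1 / e\<close>, in the average.\<close>

lemma outer_collar_power_bound:
  fixes s :: real
  assumes moran: "(\<Sum>i=1..N. r i powr s) = 1" and s: "s \<le> DIM('a)"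
  shows "\<exists>k>0. \<exists>M\<ge>0. \<forall>e. 0 < e \<and> e \<le> 1 \<longrightarrow> e powr (s - DIM('a)) * outer_collar e \<le> M * e powr k"
proof -
  obtain s' M \<alpha> where s': "s' < s" and M: "0 \<le> M" and \<alpha>: "0 < \<alpha>"
    and bound: "\<And>e. 0 < e \<Longrightarrow> e \<le> \<alpha> \<Longrightarrow> outer_collar e \<le> M * e powr (real DIM('a) - s')"
    using outer_collar_growth[OF assms] by blast
  define t where "t = real DIM('a) - s'"
  have t: "0 \<le> t"
    using s s' by (simp add: t_def)
  define M' where "M' = M + outer_collar 1 / \<alpha> powr t"
  have le: "outer_collar e \<le> M' * e powr t" if e: "0 < e" "e \<le> 1" for e
  proof (cases "e \<le> \<alpha>")
    case True
    then have "outer_collar e \<le> M * e powr t"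
      using bound e by (simp add: t_def)
    also have "\<dots> \<le> M' * e powr t"
      using outer_collar_nonneg by (intro mult_right_mono) (auto simp: M'_def)
    finally show ?thesis .
  next
    case False
    have "outer_collar e \<le> outer_collar 1"
      using e by (intro monoD[OF outer_collar_mono])
    also have "\<dots> = outer_collar 1 / \<alpha> powr t * \<alpha> powr t"
      using \<alpha> by simp
    also have "\<dots> \<le> M' * e powr t"
      using M \<alpha> False t outer_collar_nonneg by (intro mult_mono powr_mono2) (auto simp: M'_def)
    finally show ?thesis .
  qed
  have "e powr (s - DIM('a)) * outer_collar e \<le> M' * e powr (s - s')" if e: "0 < e" "e \<le> 1" for e
  proof -
    have "e powr (s - DIM('a)) * outer_collar e \<le> e powr (s - DIM('a)) * (M' * e powr t)"
      using le[OF e] by (intro mult_left_mono) auto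
    also have "\<dots> = M' * e powr (s - s')"
      by (simp add: t_def mult.left_commute flip: powr_add)
    finally show ?thesis .
  qed
  moreover have "0 \<le> M'"
    using M outer_collar_nonneg by (simp add: M'_def)
  ultimately show ?thesis
    using s' by (intro exI[of _ "s - s'"] conjI exI[of _ M']) auto
qed

lemma outer_collar_negligible:
  fixes s :: real
  assumes moran: "(\<Sum>i=1..N. r i powr s) = 1" and s: "s \<le> DIM('a)"
  shows "((\<lambda>e. e powr (s - DIM('a)) * outer_collar e) \<longlongrightarrow> 0) (at_right 0)"
proof -
  obtain k M where k: "0 < k" and bound: "\<And>e. 0 < e \<Longrightarrow> e \<le> 1 \<Longrightarrow> e powr (s - DIM('a)) * outer_collar e \<le> M * e powr k"
    using outer_collar_power_bound[OF assms] by blast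
  note small = eventually_unit_at_right_0
  show ?thesis
  proof (rule tendsto_sandwich)
    show "\<forall>\<^sub>F e in at_right 0. 0 \<le> e powr (s - DIM('a)) * outer_collar e"
      by (simp add: outer_collar_nonneg)
    show "\<forall>\<^sub>F e in at_right 0. e powr (s - DIM('a)) * outer_collar e \<le> M * e powr k"
      using small by eventually_elim (auto intro: bound)
    have "((\<lambda>e. M * e powr k) \<longlongrightarrow> M * 0 powr k) (at_right 0)"
      using k small by (intro tendsto_intros) (auto elim!: eventually_mono)
    then show "((\<lambda>e. M * e powr k) \<longlongrightarrow> 0) (at_right 0)"
      by simp
  qed simp
qed

text \<open>A point outside \<open>closure U\<close> near \<open>closure U\<close> is near its frontier, which lies in \<open>F\<close>.\<close>

lemma outer_content_zero:
  fixes s :: real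
  assumes "(\<Sum>i=1..N. r i powr s) = 1" "s \<le> DIM('a)"
  shows "has_minkowski_content s (closure U) (- closure U) 0"
  unfolding has_minkowski_content_def
proof (rule tendsto_sandwich[OF _ _ tendsto_const outer_collar_negligible[OF assms]])
  have "parallel_set (closure U) e \<inter> - closure U \<subseteq> parallel_set F e - U" for e
  proof
    fix x assume x: "x \<in> parallel_set (closure U) e \<inter> - closure U"
    have ne: "frontier (closure U) \<noteq> {}"
      using U_nonempty U_bounded by (intro frontier_nonempty_of_bounded) auto
    have sub: "frontier (closure U) \<subseteq> F"
      using compatible interior_mono[OF closure_subset[of U]] unfolding frontier_def by auto
    have "infdist x F \<le> infdist x (frontier (closure U))"
      using sub ne by (rule infdist_mono)
    also have "\<dots> = infdist x (closure U)"
      using x ne frontier_subset_closed[OF closed_closure]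
      by (intro infdist_eq_of_frontier_subset[of x "- closure U", symmetric])
         (auto simp: frontier_complement)
    finally show "x \<in> parallel_set F e - U"
      using x F_nonempty closure_subset by (auto simp: parallel_set_def)
  qed
  then have "measure lebesgue (parallel_set (closure U) e \<inter> - closure U) \<le> outer_collar e" for e
    unfolding outer_collar_def
    by (intro measure_mono_fmeasurable sets.Int) (auto intro: open_in_sets_lebesgue)
  then show "\<forall>\<^sub>F e in at_right 0. e powr (s - real DIM('a)) * measure lebesgue (parallel_set (closure U) e \<inter> - closure U)
      \<le> e powr (s - real DIM('a)) * outer_collar e"
    by (auto intro!: always_eventually mult_left_mono)
qed (auto intro!: always_eventually)

lemma outer_collar_average:
  fixes s :: real
  assumes "(\<Sum>i=1..N. r i powr s) = 1" "s \<le> DIM('a)"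
  shows "((\<lambda>\<delta>. 1 / \<bar>ln \<delta>\<bar> * (LBINT e:{\<delta>..1}. e powr (s - DIM('a)) * outer_collar e / e)) \<longlongrightarrow> 0) (at_right 0)"
proof -
  obtain k M where k: "0 < k" and M: "0 \<le> M"
    and bound: "\<And>e. 0 < e \<Longrightarrow> e \<le> 1 \<Longrightarrow> e powr (s - DIM('a)) * outer_collar e \<le> M * e powr k"
    using outer_collar_power_bound[OF assms] by blast
  have integral_le: "(LBINT e:{\<delta>..1}. e powr (s - DIM('a)) * outer_collar e / e) \<le> M / k" if \<delta>: "0 < \<delta>" "\<delta> \<le> 1" for \<delta>
  proof -
    have cont: "continuous_on {\<delta>..1} (\<lambda>e. M * e powr (k - 1))"
      using \<delta> by (intro continuous_intros) auto
    have "(LBINT e:{\<delta>..1}. e powr (s - DIM('a)) * outer_collar e / e) \<le> (LBINT e:{\<delta>..1}. M * e powr (k - 1))"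
    proof (rule set_integral_mono)
      show "set_integrable lborel {\<delta>..1} (\<lambda>e. e powr (s - DIM('a)) * outer_collar e / e)"
        using \<delta> assms(2) by (intro set_integrable_density_Icc outer_collar_mono outer_collar_nonneg) auto
      show "set_integrable lborel {\<delta>..1} (\<lambda>e. M * e powr (k - 1))"
        using cont by (rule borel_integrable_atLeastAtMost')
      show "e powr (s - DIM('a)) * outer_collar e / e \<le> M * e powr (k - 1)" if "e \<in> {\<delta>..1}" for e
        using divide_right_mono[OF bound[of e], of e] that \<delta> powr_diff[of e k 1] by simp
    qed
    also have "\<dots> = M * 1 powr k / k - M * \<delta> powr k / k"
      unfolding set_lebesgue_integral_def
    proof (rule integral_FTC_Icc[OF \<delta>(2)])
      show "((\<lambda>e. M * e powr k / k) has_vector_derivative M * e powr (k - 1)) (at e within {\<delta>..1})"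
        if "\<delta> \<le> e" "e \<le> 1" for e
        using that \<delta> k
        by (auto intro!: derivative_eq_intros simp flip: has_real_derivative_iff_has_vector_derivative)
    qed (rule cont)
    also have "\<dots> \<le> M / k"
      using M k by simp
    finally show ?thesis .
  qed
  note small = eventually_unit_at_right_0
  show ?thesis
  proof (rule tendsto_sandwich)
    show "\<forall>\<^sub>F \<delta> in at_right 0. 1 / \<bar>ln \<delta>\<bar> * (LBINT e:{\<delta>..1}. e powr (s - DIM('a)) * outer_collar e / e) \<le> M / k / \<bar>ln \<delta>\<bar>"
      using small
    proof eventually_elim
      case (elim \<delta>)
      then show ?case
        using divide_right_mono[OF integral_le[of \<delta>], of "\<bar>ln \<delta>\<bar>"]
        by (simp only: times_divide_eq_left mult_1 abs_ge_zero less_imp_le simp_thms)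
    qed
    show "\<forall>\<^sub>F \<delta> in at_right 0. 0 \<le> 1 / \<bar>ln \<delta>\<bar> * (LBINT e:{\<delta>..1}. e powr (s - DIM('a)) * outer_collar e / e)"
      using small
    proof eventually_elim
      case (elim \<delta>)
      have "0 \<le> (LBINT e:{\<delta>..1}. e powr (s - DIM('a)) * outer_collar e / e)"
        unfolding set_lebesgue_integral_def using elim outer_collar_nonneg
        by (intro Bochner_Integration.integral_nonneg) (auto simp: indicator_def)
      then show ?case
        by simp
    qed
    show "((\<lambda>\<delta>. M / k / \<bar>ln \<delta>\<bar>) \<longlongrightarrow> 0) (at_right 0)"
      by (rule tendsto_divide_0[OF tendsto_const filterlim_at_top_imp_at_infinity[OF abs_ln_at_right_0]])
  qed simp
qed

lemma collar_renewal_instance: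
  fixes s :: real
  assumes moran: "(\<Sum>i=1..N. r i powr s) = 1" and s: "s < DIM('a)"
  shows "\<exists>M. renewal {1..N} r s DIM('a) M (measure lebesgue U) collar (inner_volume G)"
proof -
  obtain M where M: "0 \<le> M" "\<And>e. 0 < e \<Longrightarrow> e \<le> 1 \<Longrightarrow> measure lebesgue (parallel_set F e) \<le> M * e powr (DIM('a) - s)"
    using volume_growth[OF moran] s by auto
  have "collar e \<le> (M + measure lebesgue U) * e powr (DIM('a) - s)" if e: "0 < e" for e
  proof (cases "e \<le> 1")
    case True
    have "collar e \<le> M * e powr (DIM('a) - s)"
      using M(2)[OF e True] volume_split[of e] outer_collar_nonneg[of e] by linarith
    also have "\<dots> \<le> (M + measure lebesgue U) * e powr (DIM('a) - s)"
      by (intro mult_right_mono) auto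
    finally show ?thesis .
  next
    case False
    have "collar e \<le> measure lebesgue U * 1"
      using collar_le by simp
    also have "\<dots> \<le> (M + measure lebesgue U) * e powr (DIM('a) - s)"
      using False M(1) s by (intro mult_mono ge_one_powr_ge_zero) auto
    finally show ?thesis .
  qed
  moreover have "{1..N} \<noteq> {}"
    using ifs by (simp add: similarity_ifs_def)
  ultimately have "renewal {1..N} r s DIM('a) (M + measure lebesgue U) (measure lebesgue U) collar (inner_volume G)"
    by (intro renewal.intro finite_atLeastAtMost ratio moran s collar_mono collar_nonneg collar_le
        inner_volume_G_mono inner_volume_nonneg inner_volume_G_nonzero collar_renewal)
  then show ?thesis ..
qed

text \<open>Comparing volumes at a radius that exceeds all distances involved, the copies of \<open>U\<close> leave room
for the generator, so the Moran sum is below one at the dimension of the space; at zero it is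
\<open>N\<close>.\<close>

lemma moran_exponent_exists: "\<exists>s. 0 < s \<and> s < real DIM('a) \<and> (\<Sum>i=1..N. r i powr s) = 1"
proof -
  define \<Phi> where "\<Phi> t = (\<Sum>i=1..N. r i powr t)" for t
  obtain a where a: "a \<in> F"
    using F_nonempty by auto
  obtain c where c: "\<And>x. x \<in> U \<Longrightarrow> dist x a \<le> c"
    using U_bounded by (auto simp: bounded_any_center[of _ a] dist_commute)
  obtain e0 where e0: "0 < e0" "0 < inner_volume G e0"
    using inner_volume_G_nonzero by auto
  define e where "e = max e0 \<bar>c\<bar>"
  have e: "0 < e" "c \<le> e"
    using e0(1) by (auto simp: e_def)
  have full: "collar t = measure lebesgue U" if "c \<le> t" for t
  proof -
    have "infdist x F \<le> t" if "x \<in> U" for x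
      using a order_trans[OF c[OF that] \<open>c \<le> t\<close>] by (rule infdist_le2)
    then have "U \<subseteq> parallel_set F t"
      using F_nonempty by (auto simp: parallel_set_def)
    then have "parallel_set F t \<inter> U = U"
      by blast
    then show ?thesis
      by (simp add: collar_def)
  qed
  have "e \<le> e / r i" if "i \<in> {1..N}" for i
    using ratio[OF that] e by (simp add: field_simps)
  then have "collar (e / r i) = measure lebesgue U" if "i \<in> {1..N}" for i
    using order_trans[OF e(2)] that by (intro full) blast
  then have "measure lebesgue U = \<Phi> DIM('a) * measure lebesgue U + inner_volume G e"
    using collar_renewal[of e] full[OF e(2)] by (simp add: \<Phi>_def sum_distrib_right)
  moreover have "inner_volume G e0 \<le> inner_volume G e"
    by (intro monoD[OF inner_volume_G_mono]) (simp add: e_def)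
  ultimately have "0 < (1 - \<Phi> DIM('a)) * measure lebesgue U"
    using e0(2) by (simp add: algebra_simps)
  then have d: "\<Phi> DIM('a) < 1"
    using measure_U_pos by (simp add: zero_less_mult_iff)
  have "\<Phi> 0 = (\<Sum>i=1..N. 1)"
    unfolding \<Phi>_def
  proof (rule sum.cong[OF refl])
    show "r i powr 0 = 1" if "i \<in> {1..N}" for i
      using ratio[OF that] by simp
  qed
  then have zero: "1 < \<Phi> 0"
    using ifs by (simp add: similarity_ifs_def)
  have "continuous_on {0..real DIM('a)} \<Phi>"
    unfolding \<Phi>_def
  proof (intro continuous_intros)
    show "\<forall>t\<in>{0..real DIM('a)}. r i \<noteq> 0" if "i \<in> {1..N}" for i
      using ratio[OF that] by simp
  qed
  then obtain s where s: "0 \<le> s" "s \<le> real DIM('a)" "\<Phi> s = 1"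
    using IVT2'[of \<Phi> "real DIM('a)" 1 0] d zero by auto
  moreover have "s \<noteq> 0" "s \<noteq> DIM('a)"
    using s(3) d zero by auto
  ultimately show ?thesis
    by (intro exI[of _ s]) (auto simp: \<Phi>_def)
qed

text \<open>The upper bound comes from the covering by copies, the lower one from the positive limit of the
windows in the renewal equation.\<close>

lemma volume_log_ratio:
  fixes s :: real
  assumes moran: "(\<Sum>i=1..N. r i powr s) = 1" and s: "s < DIM('a)"
  shows "((\<lambda>e. ln (measure lebesgue (parallel_set F e)) / ln e) \<longlongrightarrow> DIM('a) - s) (at_right 0)"
proof -
  obtain M where "renewal {1..N} r s DIM('a) M (measure lebesgue U) collar (inner_volume G)"
    using collar_renewal_instance[OF assms] by blast
  then obtain c where c: "0 < c" "\<forall>\<^sub>F e in at_right 0. c * e powr (DIM('a) - s) \<le> collar e"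
    using renewal.w_growth_lower by blast
  obtain M where M: "\<And>e. 0 < e \<Longrightarrow> e \<le> 1 \<Longrightarrow> measure lebesgue (parallel_set F e) \<le> M * e powr (DIM('a) - s)"
    using volume_growth[OF moran] s by auto
  note small = eventually_unit_at_right_0
  show ?thesis
  proof (rule log_ratio_tendsto[OF c(1)])
    show "\<forall>\<^sub>F e in at_right 0. c * e powr (DIM('a) - s) \<le> measure lebesgue (parallel_set F e)
      \<and> measure lebesgue (parallel_set F e) \<le> M * e powr (DIM('a) - s)"
      using c(2) small
    proof eventually_elim
      case (elim e)
      then show ?case
        using M[of e] volume_split[of e] outer_collar_nonneg[of e] by simp
    qed
  qed
qed

lemma minkowski_dimension_eq_moran_exponent:
  fixes s D :: real
  assumes "(\<Sum>i=1..N. r i powr s) = 1" "s < DIM('a)" "has_minkowski_dimension F D"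
  shows "D = s"
proof -
  have "((\<lambda>e. real DIM('a) - ln (measure lebesgue (parallel_set F e)) / ln e) \<longlongrightarrow> DIM('a) - (DIM('a) - s)) (at_right 0)"
    by (intro tendsto_diff tendsto_const volume_log_ratio assms)
  then have "((\<lambda>e. real DIM('a) - ln (measure lebesgue (parallel_set F e)) / ln e) \<longlongrightarrow> s) (at_right 0)"
    by simp
  then show ?thesis
    using assms(3) tendsto_unique[OF trivial_limit_at_right_real] unfolding has_minkowski_dimension_def by blast
qed

text \<open>A positive finite content determines the logarithmic growth rate of the parallel volume.\<close>

lemma content_exponent_unique:
  fixes s t :: real
  assumes moran: "(\<Sum>i=1..N. r i powr s) = 1" "s < DIM('a)"
    and "has_minkowski_content t F UNIV m" "0 < m"
  shows "t = s"
proof -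
  have "((\<lambda>e. e powr - (DIM('a) - t) * measure lebesgue (parallel_set F e)) \<longlongrightarrow> m) (at_right 0)"
    using assms(3) by (simp add: has_minkowski_content_def)
  then have "((\<lambda>e. ln (measure lebesgue (parallel_set F e)) / ln e) \<longlongrightarrow> DIM('a) - t) (at_right 0)"
    using assms(4) by (rule log_ratio_of_content)
  then have "DIM('a) - t = DIM('a) - s"
    using volume_log_ratio[OF moran] by (rule tendsto_unique[OF trivial_limit_at_right_real])
  then show ?thesis
    by simp
qed

lemma tiling_Union: "\<Union> (tiling N S U) = T"
  by (simp add: tiling_union_def)

lemma tiling_content_iff:
  "tiling_has_minkowski_content s (tiling N S U) m
    \<longleftrightarrow> ((\<lambda>e. e powr (s - DIM('a)) * collar e) \<longlongrightarrow> m) (at_right 0)"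
  by (simp add: tiling_has_minkowski_content_def has_minkowski_content_def tiling_Union measure_parallel_T)

lemma content_F_iff_tiling:
  fixes s :: real
  assumes "(\<Sum>i=1..N. r i powr s) = 1" "s \<le> DIM('a)"
  shows "has_minkowski_content s F UNIV m \<longleftrightarrow> tiling_has_minkowski_content s (tiling N S U) m"
proof -
  have eq: "e powr (s - DIM('a)) * measure lebesgue (parallel_set F e)
      = e powr (s - DIM('a)) * collar e + e powr (s - DIM('a)) * outer_collar e" for e
    by (simp add: volume_split distrib_left)
  have "((\<lambda>e. e powr (s - DIM('a)) * collar e + e powr (s - DIM('a)) * outer_collar e) \<longlongrightarrow> m) (at_right 0)
      \<longleftrightarrow> ((\<lambda>e. e powr (s - DIM('a)) * collar e) \<longlongrightarrow> m) (at_right 0)"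
    using tendsto_add[OF _ outer_collar_negligible[OF assms], of "\<lambda>e. e powr (s - DIM('a)) * collar e" m]
      tendsto_diff[OF _ outer_collar_negligible[OF assms],
        of "\<lambda>e. e powr (s - DIM('a)) * collar e + e powr (s - DIM('a)) * outer_collar e" m]
    by auto
  then show ?thesis
    by (simp add: tiling_content_iff has_minkowski_content_def eq)
qed

lemma average_content_F:
  fixes s :: real
  assumes "(\<Sum>i=1..N. r i powr s) = 1" "s \<le> DIM('a)"
    and collar: "((\<lambda>\<delta>. 1 / \<bar>ln \<delta>\<bar> * (LBINT e:{\<delta>..1}. e powr (s - DIM('a)) * collar e / e)) \<longlongrightarrow> c) (at_right 0)"
  shows "has_average_minkowski_content s F UNIV c"
  unfolding has_average_minkowski_content_def
proof (rule Lim_transform_eventually)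
  show "((\<lambda>\<delta>. 1 / \<bar>ln \<delta>\<bar> * (LBINT e:{\<delta>..1}. e powr (s - DIM('a)) * collar e / e)
      + 1 / \<bar>ln \<delta>\<bar> * (LBINT e:{\<delta>..1}. e powr (s - DIM('a)) * outer_collar e / e)) \<longlongrightarrow> c) (at_right 0)"
    using tendsto_add[OF collar outer_collar_average[OF assms(1,2)]] by simp
  have "\<forall>\<^sub>F \<delta> in at_right (0::real). 0 < \<delta>"
    by (rule eventually_at_right_less)
  then show "\<forall>\<^sub>F \<delta> in at_right 0. 1 / \<bar>ln \<delta>\<bar> * (LBINT e:{\<delta>..1}. e powr (s - DIM('a)) * collar e / e)
      + 1 / \<bar>ln \<delta>\<bar> * (LBINT e:{\<delta>..1}. e powr (s - DIM('a)) * outer_collar e / e)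
    = 1 / \<bar>ln \<delta>\<bar> * (LBINT e:{\<delta>..1}. e powr (s - DIM('a)) * measure lebesgue (parallel_set F e \<inter> UNIV) / e)"
  proof eventually_elim
    case (elim \<delta>)
    have "(LBINT e:{\<delta>..1}. e powr (s - DIM('a)) * collar e / e + e powr (s - DIM('a)) * outer_collar e / e)
      = (LBINT e:{\<delta>..1}. e powr (s - DIM('a)) * collar e / e) + (LBINT e:{\<delta>..1}. e powr (s - DIM('a)) * outer_collar e / e)"
      using elim assms(2)
      by (intro set_integral_add set_integrable_density_Icc collar_mono collar_nonneg outer_collar_mono outer_collar_nonneg) auto
    then show ?case
      by (simp add: volume_split add_divide_distrib distrib_left)
  qed
qed

lemma average_content_tiling_iff:
  "tiling_has_average_minkowski_content s (tiling N S U) c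
    \<longleftrightarrow> ((\<lambda>\<delta>. 1 / \<bar>ln \<delta>\<bar> * (LBINT e:{\<delta>..1}. e powr (s - DIM('a)) * collar e / e)) \<longlongrightarrow> c) (at_right 0)"
  by (simp add: tiling_has_average_minkowski_content_def has_average_minkowski_content_def tiling_Union measure_parallel_T)

end

text \<open>A set of positive measure has parallel volumes bounded away from zero, which forces full dimension.\<close>

lemma attractor_null:
  fixes F :: "'a::euclidean_space set"
  assumes "compact F" "has_minkowski_dimension F D" "D < DIM('a)"
  shows "measure lebesgue F = 0"
proof (rule ccontr)
  assume "measure lebesgue F \<noteq> 0"
  then have pos: "0 < measure lebesgue F"
    using measure_nonneg[of lebesgue F] by linarith
  have fm: "parallel_set F e \<in> lmeasurable" for e
    using bounded_parallel_set[OF compact_imp_bounded[OF assms(1)]] closed_parallel_set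
    by (intro bounded_set_imp_lmeasurable closed_in_sets_lebesgue)
  have F: "F \<noteq> {}"
    using assms(2) by (simp add: has_minkowski_dimension_def)
  have "((\<lambda>e. ln (measure lebesgue (parallel_set F e)) / ln e) \<longlongrightarrow> 0) (at_right 0)"
  proof (rule log_ratio_tendsto[OF pos])
    show "\<forall>\<^sub>F e in at_right 0. measure lebesgue F * e powr 0 \<le> measure lebesgue (parallel_set F e)
      \<and> measure lebesgue (parallel_set F e) \<le> measure lebesgue (parallel_set F 1) * e powr 0"
      using eventually_unit_at_right_0
    proof eventually_elim
      case (elim e)
      have "measure lebesgue F \<le> measure lebesgue (parallel_set F e)"
      proof (rule measure_mono_fmeasurable)
        show "F \<subseteq> parallel_set F e"
          using elim by (auto simp: parallel_set_def)
        show "F \<in> sets lebesgue"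
          using assms(1) by (simp add: closed_in_sets_lebesgue compact_imp_closed)
      qed (rule fm)
      moreover have "measure lebesgue (parallel_set F e) \<le> measure lebesgue (parallel_set F 1)"
        using elim fm by (intro measure_mono_fmeasurable parallel_set_mono) (auto dest: fmeasurableD)
      ultimately show ?case
        using elim by simp
    qed
  qed
  then have "((\<lambda>e. real DIM('a) - ln (measure lebesgue (parallel_set F e)) / ln e) \<longlongrightarrow> real DIM('a) - 0) (at_right 0)"
    by (intro tendsto_diff tendsto_const)
  then have "D = real DIM('a) - 0"
    using assms(2) tendsto_unique[OF trivial_limit_at_right_real] unfolding has_minkowski_dimension_def by blast
  then show False
    using assms(3) by simp
qed

section \<open>Contents of the attractor and of the tiling\<close>

theorem theorem3p10:
  fixes N :: nat
    and S :: "nat \<Rightarrow> real ^ 'n \<Rightarrow> real ^ 'n"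
    and r :: "nat \<Rightarrow> real"
    and F U K G T :: "(real ^ 'n) set"
    and \<T> :: "(real ^ 'n) set set"
    and d D g \<eta> :: real
    and h :: "real \<Rightarrow> real"
  defines "d \<equiv> real CARD('n)"
    and "K \<equiv> closure U"
    and "G \<equiv> generator N S U"
    and "\<T> \<equiv> tiling N S U"
    and "T \<equiv> tiling_union N S U"
    and "g \<equiv> inradius G"
    and "\<eta> \<equiv> - (\<Sum>i=1..N. r i powr D * ln (r i))"
    and "h \<equiv> (\<lambda>e. inner_volume T e
                  - (\<Sum>i=1..N. indicator {0<..r i * g} e * inner_volume (S i ` T) e))"
  assumes ifs: "similarity_ifs N S r"
    and F: "self_similar_set N S F"
    and dim: "has_minkowski_dimension F D" "d - 1 < D" "D < d"
    and osc: "open_set_condition N S"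
    and strong: "strong_feasible_open_set N S F U"
    and compatible: "frontier U \<subseteq> F"
  shows "has_minkowski_content D K (- K) 0 \<and>
    (\<exists>c>0.
      set_integrable lborel {0<..} (\<lambda>e. e powr (D - d - 1) * inner_volume G e) \<and>
      c = 1 / \<eta> * (LBINT e:{0<..}. e powr (D - d - 1) * inner_volume G e) \<and>
      set_integrable lborel {0<..g} (\<lambda>e. e powr (D - d - 1) * h e) \<and>
      c = 1 / \<eta> * (LBINT e:{0<..g}. e powr (D - d - 1) * h e) \<and>
      has_average_minkowski_content D F UNIV c \<and>
      tiling_has_average_minkowski_content D \<T> c \<and>
      (minkowski_measurable F \<longleftrightarrow> tiling_minkowski_measurable D \<T>) \<and>
      (minkowski_measurable F \<longrightarrow>
        has_minkowski_content D F UNIV c \<and> tiling_has_minkowski_content D \<T> c))"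
proof -
  have d: "d = real DIM(real ^ 'n)"
    by (simp add: d_def)
  have "compact F"
    using F by (simp add: self_similar_set_def)
  interpret compatible_ifs N S r F U
  proof
    show "measure lebesgue F = 0"
      using attractor_null[OF \<open>compact F\<close> dim(1)] dim(3) d by simp
  qed (use ifs F strong compatible in \<open>auto simp: strong_feasible_open_set_def\<close>)
  obtain s where s: "0 < s" "s < real DIM(real ^ 'n)" "(\<Sum>i=1..N. r i powr s) = 1"
    using moran_exponent_exists by blast
  have "D = s"
    using minkowski_dimension_eq_moran_exponent[OF s(3,2) dim(1)] .
  then have moran: "(\<Sum>i=1..N. r i powr D) = 1" "D < DIM(real ^ 'n)" "0 < D"
    using s by auto
  obtain M where "renewal {1..N} r D DIM(real ^ 'n) M (measure lebesgue U) collar (inner_volume G)"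
    using collar_renewal_instance[OF moran(1,2)] unfolding G_def by blast
  then interpret R: renewal "{1..N}" r D "DIM(real ^ 'n)" M "measure lebesgue U" collar "inner_volume G" .
  define c where "c = R.source / R.entropy"
  have \<eta>: "R.entropy = \<eta>"
    unfolding R.entropy_def \<eta>_def ..
  have g: "0 < g"
    unfolding g_def G_def by (rule inradius_G_pos)
  have h: "h = (\<lambda>x. collar x - (\<Sum>i\<in>{1..N}. indicator {0<..r i * g} x * (r i powr DIM(real ^ 'n) * collar (x / r i))))"
    unfolding h_def T_def by (intro ext) (simp add: inner_volume_T inner_volume_image_T)
  have c_pos: "0 < c"
    using R.source_pos R.entropy_pos by (simp add: c_def)
  have average: "((\<lambda>\<delta>. 1 / \<bar>ln \<delta>\<bar> * (LBINT e:{\<delta>..1}. e powr (D - DIM(real ^ 'n)) * collar e / e)) \<longlongrightarrow> c) (at_right 0)"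
    unfolding c_def by (rule R.average_tendsto)
  have content_value: "m = c" if "tiling_has_minkowski_content D \<T> m" for m
    using that unfolding \<T>_def tiling_content_iff c_def by (rule R.limit_eq_average)
  have F_iff: "has_minkowski_content D F UNIV m \<longleftrightarrow> tiling_has_minkowski_content D \<T> m" for m
    unfolding \<T>_def using moran by (intro content_F_iff_tiling) auto
  have measurable_F: "has_minkowski_content D F UNIV c" if mm: "minkowski_measurable F"
  proof -
    obtain t m where m: "0 < m" "has_minkowski_content t F UNIV m"
      using mm unfolding minkowski_measurable_def by blast
    then have "has_minkowski_content D F UNIV m"
      using content_exponent_unique[OF moran(1,2) m(2,1)] by simp
    then show ?thesis
      using content_value F_iff by blast
  qed
  have measurable_iff: "minkowski_measurable F \<longleftrightarrow> tiling_minkowski_measurable D \<T>"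
  proof
    assume "minkowski_measurable F"
    then show "tiling_minkowski_measurable D \<T>"
      using measurable_F F_iff c_pos unfolding tiling_minkowski_measurable_def by blast
  next
    assume "tiling_minkowski_measurable D \<T>"
    then show "minkowski_measurable F"
      using F_iff moran(3) compact_imp_bounded[OF \<open>compact F\<close>]
      unfolding tiling_minkowski_measurable_def minkowski_measurable_def by (meson less_imp_le)
  qed
  show ?thesis
  proof (intro conjI exI[of _ c])
    show "has_minkowski_content D K (- K) 0"
      unfolding K_def using moran by (intro outer_content_zero) auto
    show "0 < c"
      by (rule c_pos)
    show "set_integrable lborel {0<..} (\<lambda>e. e powr (D - d - 1) * inner_volume G e)"
      unfolding d by (rule R.source_integrable)
    show "c = 1 / \<eta> * (LBINT e:{0<..}. e powr (D - d - 1) * inner_volume G e)"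
      unfolding c_def R.source_def \<eta> d by simp
    show "set_integrable lborel {0<..g} (\<lambda>e. e powr (D - d - 1) * h e)"
      unfolding d h by (rule R.truncated_difference(1)[OF g])
    show "c = 1 / \<eta> * (LBINT e:{0<..g}. e powr (D - d - 1) * h e)"
      unfolding d h R.truncated_difference(2)[OF g] c_def \<eta> by simp
    show "has_average_minkowski_content D F UNIV c"
      using moran average by (intro average_content_F) auto
    show "tiling_has_average_minkowski_content D \<T> c"
      unfolding \<T>_def average_content_tiling_iff by (rule average)
    show "minkowski_measurable F \<longleftrightarrow> tiling_minkowski_measurable D \<T>"
      by (rule measurable_iff)
    show "minkowski_measurable F \<longrightarrow> has_minkowski_content D F UNIV c \<and> tiling_has_minkowski_content D \<T> c"
      using measurable_F F_iff by blast
  qed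
qed

end
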